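(* Let $u:\mathbb D\to\mathbb R$ be a harmonic function on the unit disk $\mathbb D=\{z\in\mathbb C:|z|<1\}$, and let $E\subseteq\partial\mathbb D$ be a measurable set such that $u$ has an angular limit at every point of $E$. Let $v:\mathbb D\to\mathbb R$ be any conjugate harmonic function of $u$ in $\mathbb D$. Then $v$ has a finite angular limit at almost every point of $E$, and both boundary functions (the angular limits of $u$ and of $v$, as functions on $E$, the latter defined almost everywhere on $E$) are measurable on $E$.
   Context: Measurability and "almost every" on $\partial\mathbb D$ refer to arc length (Lebesgue) measure on the unit circle. A conjugate harmonic function of $u$ in $\mathbb D$ is a harmonic function $v:\mathbb D\to\mathbb R$ such that $u+iv$ is analytic in $\mathbb D$; it is unique up to an additive real constant. A path in $\mathbb D$ terminating at $\zeta\in\partial\mathbb D$ is called nontangential at $\zeta$ if its part in some neighborhood of $\zeta$ lies inside an angle in $\mathbb D$ with vertex at $\zeta$ (a set $\{z:\ |\arg((\zeta-z)/\zeta)|<\alpha,\ 0<|z-\zeta|<r\}$ contained in $\mathbb D$, with some $0<\alpha<\pi/2$ and $r>0$). A function has the angular limit $L$ at $\zeta$ if it tends to $L$ along all nontangential paths at $\zeta$, i.e. it tends to $L$ as $z\to\zeta$ within every such angle with vertex at $\zeta$. Angular limits are a priori allowed to be infinite ($L\in[-\infty,+\infty]$) unless they are said to be finite. *)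

theory Defs
  imports "HOL-Analysis.Analysis"
begin

definition partial_x :: "(complex \<Rightarrow> real) \<Rightarrow> complex \<Rightarrow> real" where
  "partial_x f z = frechet_derivative f (at z) 1"

definition partial_y :: "(complex \<Rightarrow> real) \<Rightarrow> complex \<Rightarrow> real" where
  "partial_y f z = frechet_derivative f (at z) \<i>"

definition C1_on :: "(complex \<Rightarrow> real) \<Rightarrow> complex set \<Rightarrow> bool" where
  "C1_on f S \<longleftrightarrow>
     (\<forall>z\<in>S. f differentiable (at z)) \<and>
     continuous_on S (partial_x f) \<and> continuous_on S (partial_y f)"

text \<open>
  Classical definition: twice continuously differentiable with vanishing Laplacian.
  The set \<open>S\<close> is meant to be open; only the values of \<open>f\<close> on \<open>S\<close> then matter.
\<close>

definition harmonic_on :: "(complex \<Rightarrow> real) \<Rightarrow> complex set \<Rightarrow> bool" where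
  "harmonic_on f S \<longleftrightarrow>
     C1_on f S \<and> C1_on (partial_x f) S \<and> C1_on (partial_y f) S \<and>
     (\<forall>z\<in>S. partial_x (partial_x f) z + partial_y (partial_y f) z = 0)"

definition harmonic_conjugate_on ::
    "(complex \<Rightarrow> real) \<Rightarrow> (complex \<Rightarrow> real) \<Rightarrow> complex set \<Rightarrow> bool" where
  "harmonic_conjugate_on u v S \<longleftrightarrow>
     harmonic_on v S \<and> (\<lambda>z. complex_of_real (u z) + \<i> * complex_of_real (v z)) analytic_on S"

text \<open>
  Arc length measure on the unit circle, completed, so that its measurable sets are the
  Lebesgue measurable subsets of the circle and not only the Borel ones.
\<close>

definition arc_length :: "complex measure" where
  "arc_length =
     completion (distr (restrict_space lborel {0..<2 * pi}) (restrict_space borel (sphere 0 1)) cis)"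

text \<open>
  The condition \<open>0 < dist z \<zeta>\<close> also excludes the point where \<open>Arg 0 = 0\<close> is a mere convention.
\<close>

definition angle_at :: "complex \<Rightarrow> real \<Rightarrow> real \<Rightarrow> complex set" where
  "angle_at \<zeta> \<alpha> r = {z. \<bar>Arg ((\<zeta> - z) / \<zeta>)\<bar> < \<alpha> \<and> 0 < dist z \<zeta> \<and> dist z \<zeta> < r}"

text \<open>
  The type of the limit decides whether infinite limits are admitted: a real-valued function
  has a finite angular limit when used as is, and a possibly infinite one after
  composition with \<open>ereal\<close>.
\<close>

definition has_angular_limit ::
    "(complex \<Rightarrow> 'a::topological_space) \<Rightarrow> 'a \<Rightarrow> complex \<Rightarrow> bool" where
  "has_angular_limit f L \<zeta> \<longleftrightarrow>
     (\<forall>\<alpha> r. 0 < \<alpha> \<and> \<alpha> < pi / 2 \<and> 0 < r \<and> angle_at \<zeta> \<alpha> r \<subseteq> ball 0 1 \<longrightarrow>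
        (f \<longlongrightarrow> L) (at \<zeta> within angle_at \<zeta> \<alpha> r))"

text \<open>
  Only meaningful at points of the unit circle where the limit exists; it is then unique
  in a Hausdorff space.
\<close>

definition angular_limit :: "(complex \<Rightarrow> 'a::t2_space) \<Rightarrow> complex \<Rightarrow> 'a" where
  "angular_limit f \<zeta> = (THE L. has_angular_limit f L \<zeta>)"

end

theory Submission
  imports Defs "HOL-Complex_Analysis.Complex_Analysis"
begin

text \<open>
  Write \<open>f = u + \<i> * v\<close>. Where \<open>u\<close> has an angular limit other than \<open>\<infinity>\<close>, it is bounded above in an angle close to its vertex;
  where the limit is \<open>\<infinity>\<close>, the same is true of \<open>- u\<close>. So it suffices to show that an analytic function
  \<open>f\<close> has a finite angular limit at almost every boundary point at which \<open>Re f\<close> is bounded above in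
  an angle, and to apply this to \<open>f\<close> and \<open>- f\<close>. The substitution \<open>z = exp (\<i> * w)\<close> moves the problem to
  the upper half plane; the statement there is \<open>local_privalov\<close>.

  The function \<open>G = exp f\<close> is bounded in the angles in question and has no zeros. If it has an angular limit
  different from 0, then \<open>f\<close>, being a continuous logarithm of it, converges too. It remains to see that \<open>G\<close>
  has an angular limit almost everywhere on each set \<open>K\<close> over whose points it is bounded by one constant up
  to one height (\<open>local_fatou\<close>), and that this limit is almost never 0 (\<open>local_uniqueness\<close>).

  For the first, a primitive \<open>F\<close> of \<open>G\<close> has Lipschitz
  boundary values on \<open>K\<close>, which are differentiable almost everywhere along \<open>K\<close>, and almost all
  points of \<open>K\<close> are points of density. At such a point, \<open>F\<close> minus its linear approximation is small compared with the scale on a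
  line just above the boundary, hence, by a two-constants estimate, small in Stolz regions; by Cauchy's
  inequality so is its derivative \<open>G - c\<close> (\<open>nontangential_limit_at_boundary_derivative\<close>). The
  differentiability of Lipschitz functions comes from Vitali's covering theorem
  (\<open>lipschitz_differentiable_ae\<close>).

  For the second, if \<open>G\<close> tends to 0 on a set of positive measure, then this set fills most of some
  interval, and the maximum principle on the sawtooth region over it, with an explicit Poisson-like integral
  as a barrier on the teeth, forces \<open>G\<close> to vanish at an interior point (\<open>sawtooth_bound\<close>).

  Both boundary functions are limits of the continuous functions obtained by restricting \<open>u\<close> and \<open>v\<close> to
  smaller circles, hence measurable.
\<close>

section \<open>Almost everywhere differentiability of Lipschitz functions\<close>

text \<open>
  A Vitali covering of \<open>S\<close> by disjoint intervals inside an open set \<open>U\<close> that is hardly larger than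
  \<open>S\<close> transports the inequality from the intervals to \<open>S\<close>; domination by Lebesgue measure controls
  what \<open>\<mu>\<close> gives to \<open>U - S\<close>. The factor \<open>q\<close> is the density that \<open>\<mu>\<close> has at arbitrarily small scales.
\<close>

lemma vitali_measure_comparison:
  fixes S :: "real set" and \<mu> :: "real measure" and q :: ennreal
  assumes sets[measurable_cong]: "sets \<mu> = sets borel"
    and dom: "\<And>A. A \<in> sets borel \<Longrightarrow> emeasure \<mu> A \<le> emeasure lborel A"
    and S[measurable]: "S \<in> sets borel"
    and fine: "\<And>x d. x \<in> S \<Longrightarrow> 0 < d \<Longrightarrow>
      \<exists>a r. 0 < r \<and> r < d \<and> x \<in> cball a r \<and> q * emeasure lborel (cball a r) \<le> emeasure \<mu> (cball a r)"
  shows "q * emeasure lborel S \<le> emeasure \<mu> S"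
proof (rule ennreal_le_epsilon)
  fix e :: real assume e: "0 < e"
  obtain U where U: "open U" "S \<subseteq> U" "U - S \<in> lmeasurable" "emeasure lebesgue (U - S) < ennreal e"
    using sets_lebesgue_outer_open[of S e] e by auto
  have US: "emeasure lborel (U - S) < ennreal e"
    using U by simp
  \<comment> \<open>Only intervals inside \<open>U\<close> are admitted, so that \<open>\<mu>\<close> of their union is at most \<open>\<mu> U\<close>.\<close>
  define K where "K = {(a, r). 0 < r \<and> cball a r \<subseteq> U \<and>
     q * emeasure lborel (cball a r) \<le> emeasure \<mu> (cball a r)}"
  have "\<exists>i\<in>K. x \<in> cball (fst i) (snd i) \<and> snd i < d" if "x \<in> S" and "0 < d" for x d
  proof -
    obtain \<rho> where \<rho>: "\<rho> > 0" "ball x \<rho> \<subseteq> U"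
      using U \<open>x \<in> S\<close> by (meson openE subsetD)
    obtain a r where ar: "0 < r" "r < min d (\<rho>/2)" "x \<in> cball a r"
      "q * emeasure lborel (cball a r) \<le> emeasure \<mu> (cball a r)"
    proof -
      have "0 < min d (\<rho>/2)" using \<open>0 < \<rho>\<close> \<open>0 < d\<close> by simp
      from fine[OF \<open>x \<in> S\<close> this] show thesis using that by blast
    qed
    have "cball a r \<subseteq> ball x \<rho>"
    proof
      fix y assume "y \<in> cball a r"
      then have "dist x y \<le> r + r" using ar(3) by (auto simp: dist_real_def)
      then show "y \<in> ball x \<rho>" using ar(2) by simp
    qed
    then have "(a, r) \<in> K" using ar \<rho> by (auto simp: K_def)
    then show ?thesis using ar by force
  qed
  note fineK = this
  have posK: "0 < snd i" if "i \<in> K" for i using that by (auto simp: K_def)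
  have KU: "cball (fst i) (snd i) \<subseteq> U" if "i \<in> K" for i
    using that by (cases i) (simp add: K_def)
  obtain C where C: "countable C" "C \<subseteq> K"
    "pairwise (\<lambda>i j. disjnt (cball (fst i) (snd i)) (cball (fst j) (snd j))) C"
    "negligible (S - (\<Union>i\<in>C. cball (fst i) (snd i)))"
  proof (rule Vitali_covering_theorem_cballs[of K snd S fst])
    show "\<exists>i. i \<in> K \<and> x \<in> cball (fst i) (snd i) \<and> snd i < d" if "x \<in> S" "0 < d" for x d
      using fineK[OF that] by blast
  qed (use posK in blast)+
  let ?B = "\<lambda>i::real \<times> real. cball (fst i) (snd i)"
  have disj: "disjoint_family_on ?B C"
    using C(3) by (auto simp: disjoint_family_on_def pairwise_def disjnt_def)
  have Bm: "(\<Union>i\<in>C. ?B i) \<in> sets borel"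
    using C(1) by (intro sets.countable_UN'') auto
  have null: "emeasure lborel (S - (\<Union>i\<in>C. ?B i)) = 0"
  proof -
    have "S - (\<Union>i\<in>C. ?B i) \<in> sets borel" using Bm S by blast
    moreover have "S - (\<Union>i\<in>C. ?B i) \<in> null_sets lebesgue"
      using C(4) by (simp add: negligible_iff_null_sets)
    ultimately show ?thesis by (auto simp: null_sets_def)
  qed
  have "emeasure lborel S \<le> emeasure lborel ((\<Union>i\<in>C. ?B i) \<union> (S - (\<Union>i\<in>C. ?B i)))"
    using Bm S by (intro emeasure_mono) auto
  also have "\<dots> \<le> emeasure lborel (\<Union>i\<in>C. ?B i) + emeasure lborel (S - (\<Union>i\<in>C. ?B i))"
    using Bm S by (intro emeasure_subadditive) auto
  finally have "emeasure lborel S \<le> emeasure lborel (\<Union>i\<in>C. ?B i)"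
    using null by simp
  then have "q * emeasure lborel S \<le> q * emeasure lborel (\<Union>i\<in>C. ?B i)"
    by (rule mult_left_mono) simp
  also have "emeasure lborel (\<Union>i\<in>C. ?B i) = (\<integral>\<^sup>+i. emeasure lborel (?B i) \<partial>count_space C)"
    using C(1) disj by (intro emeasure_UN_countable) auto
  also have "q * \<dots> = (\<integral>\<^sup>+i. q * emeasure lborel (?B i) \<partial>count_space C)"
    by (simp add: nn_integral_cmult)
  also have "\<dots> \<le> (\<integral>\<^sup>+i. emeasure \<mu> (?B i) \<partial>count_space C)"
    using C(2) by (intro nn_integral_mono) (auto simp: K_def)
  also have "\<dots> = emeasure \<mu> (\<Union>i\<in>C. ?B i)"
    using C(1) disj by (intro emeasure_UN_countable[symmetric]) (auto simp: sets)
  also have "\<dots> \<le> emeasure \<mu> U"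
  proof (rule emeasure_mono)
    show "(\<Union>i\<in>C. ?B i) \<subseteq> U" using C(2) KU by blast
  qed (use U sets in auto)
  also have "\<dots> \<le> emeasure \<mu> (S \<union> (U - S))"
    using U by (intro emeasure_mono) (auto simp: sets)
  also have "\<dots> \<le> emeasure \<mu> S + emeasure \<mu> (U - S)"
    using U by (intro emeasure_subadditive) (auto simp: sets)
  also have "emeasure \<mu> (U - S) \<le> ennreal e"
    using dom[of "U - S"] US U by auto
  finally show "q * emeasure lborel S \<le> emeasure \<mu> S + ennreal e"
    by (simp add: add_left_mono)
qed

lemma emeasure_lborel_eq_0_if_bounded_parts_null:
  fixes Z :: "real set"
  assumes Z: "Z \<in> sets borel" and null: "\<And>n. emeasure lborel (Z \<inter> {-real n..real n}) = 0"
  shows "emeasure lborel Z = 0"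
proof -
  have "(\<Union>n. Z \<inter> {-real n..real n}) \<in> null_sets lborel"
    using Z null by (intro null_sets_UN) (auto simp: null_sets_def)
  moreover have "(\<Union>n. Z \<inter> {-real n..real n}) = Z"
  proof -
    have "\<exists>n. x \<in> {-real n..real n}" for x :: real
    proof -
      obtain m :: nat where "\<bar>x\<bar> \<le> real m" using real_arch_simple by blast
      then have "x \<in> {-real m..real m}" by auto
      then show ?thesis ..
    qed
    then show ?thesis by blast
  qed
  ultimately show ?thesis by (auto simp: null_sets_def)
qed

text \<open>
  A weak form of the Lebesgue density theorem: some short interval is filled by \<open>Z\<close> up to a small
  proportion. Otherwise Lebesgue measure restricted to the complement of \<open>Z\<close>, which does not charge
  \<open>Z\<close>, would have positive density at every point of \<open>Z\<close>.
\<close>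

lemma interval_of_high_density:
  fixes Z :: "real set"
  assumes Z[measurable]: "Z \<in> sets borel" and pos: "emeasure lborel Z > 0" and "0 < e" "0 < d"
  obtains p T where "0 < T" "T < d" "emeasure lborel (cball p T - Z) < ennreal (e * T)"
proof (rule ccontr)
  assume "\<not> thesis"
  note not = that this
  obtain n :: nat where n: "emeasure lborel (Z \<inter> {-real n..real n}) > 0"
  proof -
    have "\<exists>n. emeasure lborel (Z \<inter> {-real n..real n}) \<noteq> 0"
    proof (rule ccontr)
      assume "\<not> ?thesis"
      then have "emeasure lborel (Z \<inter> {-real n..real n}) = 0" for n by simp
      from emeasure_lborel_eq_0_if_bounded_parts_null[OF Z this] pos show False by simp
    qed
    then show thesis using that by (auto simp: zero_less_iff_neq_zero)
  qed
  define S where "S = Z \<inter> {-real n..real n}"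
  have [measurable]: "S \<in> sets borel" by (simp add: S_def)
  define \<mu> where "\<mu> = density lborel (indicator (- Z) :: real \<Rightarrow> ennreal)"
  have em: "emeasure \<mu> A = emeasure lborel (A - Z)" if [measurable]: "A \<in> sets borel" for A
  proof -
    have "emeasure \<mu> A = (\<integral>\<^sup>+x. indicator (-Z) x * indicator A x \<partial>lborel)"
      unfolding \<mu>_def by (rule emeasure_density) auto
    also have "\<dots> = (\<integral>\<^sup>+x. indicator (A - Z) x \<partial>lborel)"
      by (intro nn_integral_cong) (auto split: split_indicator)
    finally show ?thesis by simp
  qed
  have "ennreal (e/2) * emeasure lborel S \<le> emeasure \<mu> S"
  proof (rule vitali_measure_comparison)
    show "\<exists>a r. 0 < r \<and> r < d' \<and> x \<in> cball a r \<and>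
        ennreal (e/2) * emeasure lborel (cball a r) \<le> emeasure \<mu> (cball a r)"
      if "0 < d'" for x d'
    proof -
      define r where "r = min d d' / 2"
      have r: "0 < r" "r < d" "r < d'" using that \<open>0 < d\<close> by (auto simp: r_def)
      have "ennreal (e * r) \<le> emeasure lborel (cball x r - Z)"
        using not(1)[of r x] not(2) r by fastforce
      moreover have "ennreal (e/2) * emeasure lborel (cball x r) = ennreal (e * r)"
        using r \<open>0 < e\<close> by (simp add: cball_eq_atLeastAtMost flip: ennreal_mult)
      ultimately show ?thesis using r em[of "cball x r"] by (intro exI[of _ x] exI[of _ r]) auto
    qed
    show "emeasure \<mu> A \<le> emeasure lborel A" if "A \<in> sets borel" for A
      using that by (auto simp: em intro!: emeasure_mono)
  qed (auto simp: \<mu>_def)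
  moreover have "emeasure \<mu> S = 0"
  proof -
    have "S - Z = {}" by (auto simp: S_def)
    with em[of S] show ?thesis by (metis \<open>S \<in> sets borel\<close> emeasure_empty)
  qed
  ultimately show False using n \<open>0 < e\<close> by (auto simp: S_def ennreal_eq_0_iff)
qed

lemma monotone_contraction_continuous:
  fixes \<phi> :: "real \<Rightarrow> real"
  assumes incr: "\<And>a b. a \<le> b \<Longrightarrow> 0 \<le> \<phi> b - \<phi> a \<and> \<phi> b - \<phi> a \<le> b - a"
  shows "continuous_on UNIV \<phi>"
proof (rule lipschitz_on_continuous_on, rule lipschitz_onI)
  show "dist (\<phi> x) (\<phi> y) \<le> 1 * dist x y" for x y
    using incr[of x y] incr[of y x] by (cases "x \<le> y") (auto simp: dist_real_def)
qed simp

text \<open>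
  The Stieltjes measures of \<open>\<phi>\<close> and of \<open>x - \<phi> x\<close> have sum Lebesgue measure, since this holds on
  intervals. Hence an upper bound for the slopes of \<open>\<phi>\<close> is a lower bound for those of \<open>x - \<phi> x\<close>, and
  the one-sided comparison \<open>vitali_measure_comparison\<close> suffices for both.
\<close>

lemma interval_measure_plus_complement:
  fixes \<phi> :: "real \<Rightarrow> real"
  assumes incr: "\<And>a b. a \<le> b \<Longrightarrow> 0 \<le> \<phi> b - \<phi> a \<and> \<phi> b - \<phi> a \<le> b - a"
    and A: "A \<in> sets borel"
  shows "emeasure (interval_measure \<phi>) A + emeasure (interval_measure (\<lambda>x. x - \<phi> x)) A = emeasure lborel A"
proof -
  let ?\<psi> = "\<lambda>x. x - \<phi> x"
  let ?f = "\<lambda>A. emeasure (interval_measure \<phi>) A + emeasure (interval_measure ?\<psi>) A"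
  define M where "M = measure_of UNIV (sets (borel :: real measure)) ?f"
  have setsM: "sets M = sets borel"
    unfolding M_def using sets.sigma_sets_eq[of "borel :: real measure"] by (simp add: sets_measure_of_conv)
  have cont: "continuous_on UNIV \<phi>"
    by (rule monotone_contraction_continuous[OF incr])
  have cont': "continuous_on UNIV ?\<psi>"
    using cont by (intro continuous_intros)
  have emM: "emeasure M A = ?f A" if "A \<in> sets borel" for A
    unfolding M_def
  proof (rule emeasure_measure_of_sigma)
    show "sigma_algebra UNIV (sets (borel :: real measure))"
      using sets.sigma_algebra_axioms[of "borel :: real measure"] by simp
    show "positive (sets (borel :: real measure)) ?f" by (simp add: positive_def)
    show "countably_additive (sets (borel :: real measure)) ?f"
    proof (rule countably_additiveI)
      fix X :: "nat \<Rightarrow> real set" assume X: "range X \<subseteq> sets borel" "disjoint_family X"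
      have "(\<Sum>i. ?f (X i)) = (\<Sum>i. emeasure (interval_measure \<phi>) (X i)) + (\<Sum>i. emeasure (interval_measure ?\<psi>) (X i))"
        by (simp add: suminf_add)
      then show "(\<Sum>i. ?f (X i)) = ?f (\<Union>i. X i)"
        using X by (simp add: suminf_emeasure)
    qed
    show "A \<in> sets borel" by fact
  qed
  have open_int: "emeasure (interval_measure F) {l<..<u} = ennreal (F u - F l)"
    if "l \<le> u" and m: "\<And>x y. x \<le> y \<Longrightarrow> F x \<le> F y" and c: "continuous_on UNIV F" for l u F
  proof -
    have s: "emeasure (interval_measure F) {u} = 0"
      using emeasure_interval_measure_Icc[OF order_refl m c, of u] by simp
    have rc: "continuous (at_right a) F" for a
      using c by (meson UNIV_I continuous_at_imp_continuous_at_within continuous_on_eq_continuous_at open_UNIV)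
    show ?thesis
    proof (cases "l < u")
      case True
      have "emeasure (interval_measure F) {l<..u} = emeasure (interval_measure F) ({l<..<u} \<union> {u})"
        using True by (intro arg_cong2[where f=emeasure]) auto
      also have "\<dots> = emeasure (interval_measure F) {l<..<u}"
        using s by (intro emeasure_Un_null_set) auto
      finally show ?thesis
        using emeasure_interval_measure_Ioc[OF \<open>l \<le> u\<close> m rc] by simp
    qed (use that in auto)
  qed
  have "lborel = M"
  proof (rule lborel_eqI)
    fix l u :: real assume "\<And>b. b \<in> Basis \<Longrightarrow> l \<bullet> b \<le> u \<bullet> b"
    then have "l \<le> u" by simp
    have "emeasure M {l<..<u} = ennreal (\<phi> u - \<phi> l) + ennreal (?\<psi> u - ?\<psi> l)"
    proof -
      have "emeasure (interval_measure \<phi>) {l<..<u} = ennreal (\<phi> u - \<phi> l)"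
        using incr cont \<open>l \<le> u\<close> by (intro open_int) force+
      moreover have "emeasure (interval_measure ?\<psi>) {l<..<u} = ennreal (?\<psi> u - ?\<psi> l)"
      proof (rule open_int[OF \<open>l \<le> u\<close> _ cont'])
        show "x - \<phi> x \<le> y - \<phi> y" if "x \<le> y" for x y using incr[OF that] by simp
      qed
      ultimately show ?thesis by (simp add: emM)
    qed
    also have "\<dots> = ennreal (u - l)"
      using incr[OF \<open>l \<le> u\<close>] by (simp flip: ennreal_plus)
    finally show "emeasure M (box l u) = ennreal (\<Prod>b\<in>Basis. (u - l) \<bullet> b)"
      by (simp add: box_real)
  qed (rule setsM)
  then show ?thesis using emM[OF A] by simp
qed

text \<open>
  Slopes below \<open>p\<close> and slopes above \<open>q > p\<close> at all small scales around the points of a set \<open>S\<close> of finite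
  measure force \<open>(1 - p) * \<bar>S\<bar> \<le> \<nu> S\<close> and \<open>q * \<bar>S\<bar> \<le> \<mu> S\<close> for the two complementary
  Stieltjes measures, so that \<open>(1 - p + q) * \<bar>S\<bar> \<le> \<bar>S\<bar>\<close> and \<open>\<bar>S\<bar> = 0\<close>.
\<close>

lemma no_slope_oscillation_ae:
  fixes \<phi> :: "real \<Rightarrow> real"
  assumes incr: "\<And>a b. a \<le> b \<Longrightarrow> 0 \<le> \<phi> b - \<phi> a \<and> \<phi> b - \<phi> a \<le> b - a" and "p < q"
  shows "AE x in lborel. \<not> ((\<forall>d>0. \<exists>a b. a < x \<and> x < b \<and> b - a < d \<and> \<phi> b - \<phi> a < p * (b - a)) \<and>
                            (\<forall>d>0. \<exists>a b. a < x \<and> x < b \<and> b - a < d \<and> \<phi> b - \<phi> a > q * (b - a)))"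
proof -
  \<comment> \<open>Demanding \<open>x\<close> strictly inside the small intervals makes this a countable intersection of open sets.\<close>
  define X where "X P = {x::real. \<forall>d>0. \<exists>a b. a < x \<and> x < b \<and> b - a < d \<and> P a b}" for P
  have X_borel: "X P \<in> sets borel" for P
  proof -
    have "X P = (\<Inter>n::nat. \<Union>(a,b)\<in>{(a,b). b - a < 1 / real (Suc n) \<and> P a b}. {a<..<b})"
    proof safe
      fix x n assume "x \<in> X P"
      moreover have "0 < 1 / real (Suc n)" by simp
      ultimately obtain a b where "a < x" "x < b" "b - a < 1 / real (Suc n)" "P a b"
        unfolding X_def by blast
      then show "x \<in> (\<Union>(a,b)\<in>{(a,b). b - a < 1 / real (Suc n) \<and> P a b}. {a<..<b})" by auto
    next
      fix x assume x: "x \<in> (\<Inter>n::nat. \<Union>(a,b)\<in>{(a,b). b - a < 1 / real (Suc n) \<and> P a b}. {a<..<b})"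
      show "x \<in> X P" unfolding X_def
      proof safe
        fix d :: real assume "0 < d"
        then obtain n where "1 / real (Suc n) < d" using nat_approx_posE by blast
        moreover obtain a b where "b - a < 1 / real (Suc n)" "P a b" "a < x" "x < b"
          using x by fastforce
        ultimately show "\<exists>a b. a < x \<and> x < b \<and> b - a < d \<and> P a b"
          by (meson order.strict_trans)
      qed
    qed
    also have "\<dots> \<in> sets borel"
      by (intro sets.countable_INT'' borel_open open_UN) auto
    finally show ?thesis .
  qed
  let ?\<psi> = "\<lambda>x. x - \<phi> x"
  let ?L = "\<lambda>a b. \<phi> b - \<phi> a < p * (b - a)" and ?G = "\<lambda>a b. \<phi> b - \<phi> a > q * (b - a)"
  have sum: "emeasure (interval_measure \<phi>) A + emeasure (interval_measure ?\<psi>) A = emeasure lborel A"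
    if "A \<in> sets borel" for A
    using interval_measure_plus_complement[OF incr that] by simp
  have cont: "continuous_on UNIV \<phi>"
    by (rule monotone_contraction_continuous[OF incr])
  have icc: "emeasure (interval_measure \<phi>) {a..b} = \<phi> b - \<phi> a"
    "emeasure (interval_measure ?\<psi>) {a..b} = ?\<psi> b - ?\<psi> a" if "a \<le> b" for a b
  proof -
    show "emeasure (interval_measure \<phi>) {a..b} = \<phi> b - \<phi> a"
      using incr cont that by (intro emeasure_interval_measure_Icc) force+
    show "emeasure (interval_measure ?\<psi>) {a..b} = ?\<psi> b - ?\<psi> a"
    proof (rule emeasure_interval_measure_Icc[OF that])
      show "x - \<phi> x \<le> y - \<phi> y" if "x \<le> y" for x y using incr[OF that] by simp
    qed (use cont in \<open>intro continuous_intros\<close>)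
  qed
  have zero: "emeasure lborel (X ?L \<inter> X ?G \<inter> {-real n..real n}) = 0" for n
  proof -
    define S where "S = X ?L \<inter> X ?G \<inter> {-real n..real n}"
    have S: "S \<in> sets borel" unfolding S_def using X_borel by auto
    have small_balls: "\<exists>c r. 0 < r \<and> r < d \<and> x \<in> cball c r \<and> P (c - r) (c + r)"
      if x: "x \<in> X P" and d: "0 < d" for x d :: real and P
    proof -
      obtain a b where ab: "a < x" "x < b" "b - a < d" "P a b"
        using x d unfolding X_def by blast
      have e: "(a+b)/2 - (b-a)/2 = a" "(a+b)/2 + (b-a)/2 = b" by (simp_all add: field_simps)
      have "x \<in> cball ((a+b)/2) ((b-a)/2)"
        using ab by (simp add: cball_eq_atLeastAtMost e)
      moreover have "P ((a+b)/2 - (b-a)/2) ((a+b)/2 + (b-a)/2)" unfolding e by (rule ab)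
      moreover have "0 < (b-a)/2" "(b-a)/2 < d" using ab by simp_all
      ultimately show ?thesis by blast
    qed
    have 1: "ennreal q * emeasure lborel S \<le> emeasure (interval_measure \<phi>) S"
    proof (rule vitali_measure_comparison[OF _ _ S])
      show "emeasure (interval_measure \<phi>) A \<le> emeasure lborel A" if "A \<in> sets borel" for A
        using sum[OF that] by (metis le_iff_add)
      show "\<exists>a r. 0 < r \<and> r < d \<and> x \<in> cball a r \<and>
          ennreal q * emeasure lborel (cball a r) \<le> emeasure (interval_measure \<phi>) (cball a r)"
        if xd: "x \<in> S" "0 < d" for x d
      proof -
        obtain c r where cr: "0 < r" "r < d" "x \<in> cball c r" "?G (c - r) (c + r)"
          using small_balls[of x ?G d] xd by (auto simp: S_def)
        have "ennreal q * emeasure lborel (cball c r) = ennreal (q * (2 * r))"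
          using cr by (simp add: cball_eq_atLeastAtMost ennreal_mult'')
        also have "\<dots> \<le> emeasure (interval_measure \<phi>) (cball c r)"
          using cr by (simp add: cball_eq_atLeastAtMost icc ennreal_leI)
        finally show ?thesis using cr by blast
      qed
    qed simp
    have 2: "ennreal (1 - p) * emeasure lborel S \<le> emeasure (interval_measure ?\<psi>) S"
    proof (rule vitali_measure_comparison[OF _ _ S])
      show "emeasure (interval_measure ?\<psi>) A \<le> emeasure lborel A" if "A \<in> sets borel" for A
        using sum[OF that] by (metis le_iff_add add.commute)
      show "\<exists>a r. 0 < r \<and> r < d \<and> x \<in> cball a r \<and>
          ennreal (1 - p) * emeasure lborel (cball a r) \<le> emeasure (interval_measure ?\<psi>) (cball a r)"
        if xd: "x \<in> S" "0 < d" for x d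
      proof -
        obtain c r where cr: "0 < r" "r < d" "x \<in> cball c r" "?L (c - r) (c + r)"
          using small_balls[of x ?L d] xd by (auto simp: S_def)
        have "ennreal (1 - p) * emeasure lborel (cball c r) = ennreal ((1 - p) * (2 * r))"
          using cr by (simp add: cball_eq_atLeastAtMost ennreal_mult'')
        also have "\<dots> \<le> emeasure (interval_measure ?\<psi>) (cball c r)"
          using cr by (auto simp: cball_eq_atLeastAtMost icc algebra_simps intro!: ennreal_leI)
        finally show ?thesis using cr by blast
      qed
    qed simp
    have fin: "emeasure lborel S < \<infinity>"
    proof -
      have "emeasure lborel S \<le> emeasure lborel {-real n..real n}"
        by (intro emeasure_mono) (auto simp: S_def)
      then show ?thesis by (simp add: order_le_less_trans)
    qed
    define s where "s = measure lborel S"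
    have s: "emeasure lborel S = ennreal s" "0 \<le> s"
      using fin by (auto simp: s_def emeasure_eq_ennreal_measure)
    \<comment> \<open>Adding both estimates gives \<open>(1 + (q - p)) * s \<le> s\<close>.\<close>
    have "ennreal ((q + (1 - p)) * s) \<le> (ennreal q + ennreal (1 - p)) * ennreal s"
    proof -
      have "ennreal (q + (1 - p)) \<le> ennreal q + ennreal (1 - p)"
        by (cases "0 \<le> q"; cases "0 \<le> 1 - p")
           (auto simp: ennreal_neg simp flip: ennreal_plus intro!: ennreal_leI)
      then show ?thesis using s by (simp add: ennreal_mult'' mult_right_mono)
    qed
    also have "\<dots> \<le> ennreal s"
      using add_mono[OF 1 2] sum[OF S] s by (simp add: distrib_right)
    finally have "(q + (1 - p)) * s \<le> s" using s by simp
    then have "(q - p) * s \<le> 0" by (simp add: algebra_simps)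
    then have "s = 0" using \<open>p < q\<close> s by (smt (verit) mult_pos_pos)
    then show ?thesis using s by (simp add: S_def)
  qed
  have "emeasure lborel (X ?L \<inter> X ?G) = 0"
    by (rule emeasure_lborel_eq_0_if_bounded_parts_null[OF _ zero]) (use X_borel in auto)
  then have "X ?L \<inter> X ?G \<in> null_sets lborel"
    using X_borel by (auto simp: null_sets_def)
  then show ?thesis
    by (rule AE_I') (unfold X_def, blast)
qed

text \<open>
  Vitali's theorem speaks of intervals that contain \<open>x\<close> inside; by continuity one end may be moved
  to \<open>x\<close>.
\<close>

lemma slope_limit_imp_differentiable:
  fixes \<phi> :: "real \<Rightarrow> real"
  assumes cont: "isCont \<phi> x"
    and lim: "\<And>e. 0 < e \<Longrightarrow> \<exists>d>0. \<forall>a b. a < x \<longrightarrow> x < b \<longrightarrow> b - a < d \<longrightarrow>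
       \<bar>\<phi> b - \<phi> a - c * (b - a)\<bar> \<le> e * (b - a)"
  shows "(\<phi> has_real_derivative c) (at x)"
proof -
  have "\<exists>d>0. \<forall>y. 0 < \<bar>y - x\<bar> \<and> \<bar>y - x\<bar> < d \<longrightarrow> \<bar>\<phi> y - \<phi> x - c * (y - x)\<bar> \<le> e * \<bar>y - x\<bar>"
    if "0 < e" for e
  proof -
    obtain d where d: "d > 0" and D: "\<And>a b. a < x \<Longrightarrow> x < b \<Longrightarrow> b - a < d \<Longrightarrow>
       \<bar>\<phi> b - \<phi> a - c * (b - a)\<bar> \<le> e * (b - a)"
      using lim[OF \<open>0 < e\<close>] by blast
    have "\<bar>\<phi> y - \<phi> x - c * (y - x)\<bar> \<le> e * \<bar>y - x\<bar>" if y: "0 < \<bar>y - x\<bar>" "\<bar>y - x\<bar> < d" for y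
    proof (cases "x < y")
      case True
      have "((\<lambda>a. e * (y - a) - \<bar>\<phi> y - \<phi> a - c * (y - a)\<bar>) \<longlongrightarrow> e * (y - x) - \<bar>\<phi> y - \<phi> x - c * (y - x)\<bar>) (at_left x)"
        using cont by (intro tendsto_intros) (auto simp: isCont_def intro: filterlim_at_split[THEN iffD1, THEN conjunct1])
      moreover have "\<forall>\<^sub>F a in at_left x. 0 \<le> e * (y - a) - \<bar>\<phi> y - \<phi> a - c * (y - a)\<bar>"
      proof -
        have "y - d < x" using y True by auto
        then show ?thesis
          unfolding eventually_at_left_field by (intro exI[of _ "y - d"]) (use D[of _ y] True in auto)
      qed
      ultimately have "0 \<le> e * (y - x) - \<bar>\<phi> y - \<phi> x - c * (y - x)\<bar>"
        by (intro tendsto_lowerbound) auto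
      then show ?thesis using True by simp
    next
      case False
      then have "y < x" using y by auto
      have "((\<lambda>b. e * (b - y) - \<bar>\<phi> b - \<phi> y - c * (b - y)\<bar>) \<longlongrightarrow> e * (x - y) - \<bar>\<phi> x - \<phi> y - c * (x - y)\<bar>) (at_right x)"
        using cont by (intro tendsto_intros) (auto simp: isCont_def intro: filterlim_at_split[THEN iffD1, THEN conjunct2])
      moreover have "\<forall>\<^sub>F b in at_right x. 0 \<le> e * (b - y) - \<bar>\<phi> b - \<phi> y - c * (b - y)\<bar>"
      proof -
        have "x < y + d" using y \<open>y < x\<close> by auto
        then show ?thesis
          unfolding eventually_at_right_field by (intro exI[of _ "y + d"]) (use D[of y] \<open>y < x\<close> in auto)
      qed
      ultimately have "0 \<le> e * (x - y) - \<bar>\<phi> x - \<phi> y - c * (x - y)\<bar>"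
        by (intro tendsto_lowerbound) auto
      moreover have "\<bar>\<phi> x - \<phi> y - c * (x - y)\<bar> = \<bar>\<phi> y - \<phi> x - c * (y - x)\<bar>"
        by (simp add: abs_if algebra_simps)
      ultimately show ?thesis using \<open>y < x\<close> by simp
    qed
    then show ?thesis using d by blast
  qed
  note key = this
  have "((\<lambda>y. (\<phi> y - \<phi> x) / (y - x)) \<longlongrightarrow> c) (at x)"
    unfolding LIM_def
  proof safe
    fix r :: real assume "0 < r"
    obtain d where d: "d > 0" "\<And>y. 0 < \<bar>y - x\<bar> \<Longrightarrow> \<bar>y - x\<bar> < d \<Longrightarrow> \<bar>\<phi> y - \<phi> x - c * (y - x)\<bar> \<le> r/2 * \<bar>y - x\<bar>"
      using key[of "r/2"] \<open>0 < r\<close> by auto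
    have "\<bar>(\<phi> y - \<phi> x) / (y - x) - c\<bar> < r" if "y \<noteq> x" "\<bar>y - x\<bar> < d" for y
    proof -
      have "(\<phi> y - \<phi> x) / (y - x) - c = (\<phi> y - \<phi> x - c * (y - x)) / (y - x)"
        using that by (simp add: field_simps)
      then have "\<bar>(\<phi> y - \<phi> x) / (y - x) - c\<bar> = \<bar>\<phi> y - \<phi> x - c * (y - x)\<bar> / \<bar>y - x\<bar>"
        by (simp add: abs_divide)
      also have "\<dots> \<le> r/2" using d(2)[of y] that by (simp add: divide_le_eq)
      finally show ?thesis using \<open>0 < r\<close> by simp
    qed
    then show "\<exists>s>0. \<forall>y. y \<noteq> x \<and> dist y x < s \<longrightarrow> dist ((\<phi> y - \<phi> x) / (y - x)) c < r"
      using d(1) by (auto simp: dist_real_def)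
  qed
  then show ?thesis by (simp add: has_field_derivative_iff)
qed

text \<open>
  The derivative is the infimum of all \<open>p\<close> for which slopes below \<open>p\<close> occur at all small scales:
  outside the countably many null sets belonging to rational \<open>p < q\<close>, slopes that exceed this infimum by
  a fixed amount do not persist.
\<close>

lemma monotone_contraction_differentiable_ae:
  fixes \<phi> :: "real \<Rightarrow> real"
  assumes incr: "\<And>a b. a \<le> b \<Longrightarrow> 0 \<le> \<phi> b - \<phi> a \<and> \<phi> b - \<phi> a \<le> b - a"
  shows "AE x in lborel. \<exists>c. (\<phi> has_real_derivative c) (at x)"
proof -
  let ?S = "\<lambda>x p. \<forall>d>0. \<exists>a b. a < x \<and> x < b \<and> b - a < d \<and> \<phi> b - \<phi> a < p * (b - a)"
  let ?T = "\<lambda>x q. \<forall>d>0. \<exists>a b. a < x \<and> x < b \<and> b - a < d \<and> \<phi> b - \<phi> a > q * (b - a)"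
  have "AE x in lborel. \<forall>p\<in>\<rat>. \<forall>q\<in>\<rat>. p < q \<longrightarrow> \<not> (?S x p \<and> ?T x q)"
  proof (intro AE_ball_countable[THEN iffD2] countable_rat ballI)
    fix p q :: real
    show "AE x in lborel. p < q \<longrightarrow> \<not> (?S x p \<and> ?T x q)"
    proof (cases "p < q")
      case True then show ?thesis using no_slope_oscillation_ae[OF incr True] by simp
    qed auto
  qed
  then show ?thesis
  proof (rule AE_mp, intro AE_I2 impI)
    fix x assume no: "\<forall>p\<in>\<rat>. \<forall>q\<in>\<rat>. p < q \<longrightarrow> \<not> (?S x p \<and> ?T x q)"
    define c where "c = Inf {p. ?S x p}"
    have S2: "?S x 2"
    proof (intro allI impI)
      fix d :: real assume "d > 0"
      then show "\<exists>a b. a < x \<and> x < b \<and> b - a < d \<and> \<phi> b - \<phi> a < 2 * (b - a)"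
        using incr[of "x - d/4" "x + d/4"] by (intro exI[of _ "x - d/4"] exI[of _ "x + d/4"]) auto
    qed
    have Spos: "0 \<le> p" if S: "?S x p" for p
    proof (rule ccontr)
      assume "\<not> 0 \<le> p"
      obtain a b where ab: "a < x" "x < b" "\<phi> b - \<phi> a < p * (b - a)"
        using S zero_less_one by blast
      moreover have "p * (b - a) \<le> 0" using \<open>\<not> 0 \<le> p\<close> ab by (simp add: mult_le_0_iff)
      ultimately show False using incr[of a b] by linarith
    qed
    have bdd: "bdd_below {p. ?S x p}" using Spos by (intro bdd_belowI[of _ 0]) simp
    have Smono: "?S x p'" if "?S x p" "p \<le> p'" for p p'
    proof (intro allI impI)
      fix d :: real assume "0 < d"
      then obtain a b where ab: "a < x" "x < b" "b - a < d" "\<phi> b - \<phi> a < p * (b - a)"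
        using \<open>?S x p\<close> by blast
      moreover have "p * (b - a) \<le> p' * (b - a)" using ab that by (intro mult_right_mono) auto
      ultimately show "\<exists>a b. a < x \<and> x < b \<and> b - a < d \<and> \<phi> b - \<phi> a < p' * (b - a)"
        by (meson less_le_trans)
    qed
    have "(\<phi> has_real_derivative c) (at x)"
    proof (rule slope_limit_imp_differentiable)
      have "continuous_on UNIV \<phi>"
        by (rule monotone_contraction_continuous[OF incr])
      then show "isCont \<phi> x" by (simp add: continuous_on_eq_continuous_at)
      fix e :: real assume "0 < e"
      have notS: "\<not> ?S x (c - e)"
      proof
        assume "?S x (c - e)"
        then have "c \<le> c - e" unfolding c_def using bdd by (intro cInf_lower) auto
        then show False using \<open>0 < e\<close> by simp
      qed
      obtain d1 where d1: "d1 > 0" "\<And>a b. a < x \<Longrightarrow> x < b \<Longrightarrow> b - a < d1 \<Longrightarrow> \<phi> b - \<phi> a \<ge> (c - e) * (b - a)"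
        using notS unfolding not_all not_imp not_ex not_less de_Morgan_conj by (metis not_le)
      have ne: "{p. ?S x p} \<noteq> {}" using S2 by blast
      have "c < c + e/2" using \<open>0 < e\<close> by simp
      with cInf_lessD[OF ne, folded c_def] obtain p where p: "?S x p" "p < c + e/2" by blast
      obtain r where r: "r \<in> \<rat>" "p < r" "r < c + e/2" using Rats_dense_in_real[OF p(2)] by blast
      obtain q where q: "q \<in> \<rat>" "c + e/2 < q" "q < c + e" using Rats_dense_in_real[of "c+e/2" "c+e"] \<open>0 < e\<close> by auto
      have "?S x r" using Smono[OF p(1)] r by simp
      then have notT: "\<not> ?T x q" using no r(1) q(1) order.strict_trans[OF r(3) q(2)] by blast
      obtain d2 where d2: "d2 > 0" "\<And>a b. a < x \<Longrightarrow> x < b \<Longrightarrow> b - a < d2 \<Longrightarrow> \<phi> b - \<phi> a \<le> q * (b - a)"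
        using notT unfolding not_all not_imp not_ex not_less de_Morgan_conj by (metis not_le)
      have "\<bar>\<phi> b - \<phi> a - c * (b - a)\<bar> \<le> e * (b - a)" if "a < x" "x < b" "b - a < min d1 d2" for a b
      proof -
        have "q * (b - a) \<le> (c + e) * (b - a)" using that q by (intro mult_right_mono) auto
        then show ?thesis using d1(2)[of a b] d2(2)[of a b] that by (simp add: abs_le_iff algebra_simps)
      qed
      then show "\<exists>d>0. \<forall>a b. a < x \<longrightarrow> x < b \<longrightarrow> b - a < d \<longrightarrow> \<bar>\<phi> b - \<phi> a - c * (b - a)\<bar> \<le> e * (b - a)"
        using d1(1) d2(1) by (intro exI[of _ "min d1 d2"]) auto
    qed
    then show "\<exists>c. (\<phi> has_real_derivative c) (at x)" ..
  qed
qed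

lemma lipschitz_differentiable_ae:
  fixes \<phi> :: "real \<Rightarrow> real"
  assumes lip: "L-lipschitz_on UNIV \<phi>"
  shows "AE x in lborel. \<exists>c. (\<phi> has_real_derivative c) (at x)"
proof -
  have L: "0 \<le> L" using lip by (rule lipschitz_on_nonneg)
  define K where "K = L + 1"
  have K: "K > 0" using L by (simp add: K_def)
  have d: "\<bar>\<phi> b - \<phi> a\<bar> \<le> K * \<bar>b - a\<bar>" for a b
    using lipschitz_onD[OF lip, of b a] by (auto simp: dist_real_def K_def algebra_simps)
  \<comment> \<open>Adding a multiple of the identity makes \<open>\<phi>\<close> increasing, and scaling brings its slopes into \<open>{0..1}\<close>.\<close>
  define \<psi> where "\<psi> x = (\<phi> x / K + x) / 2" for x
  have "AE x in lborel. \<exists>c. (\<psi> has_real_derivative c) (at x)"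
  proof (rule monotone_contraction_differentiable_ae)
    fix a b :: real assume "a \<le> b"
    have "\<bar>(\<phi> b - \<phi> a) / K\<bar> \<le> b - a"
      using d[of b a] K \<open>a \<le> b\<close> by (simp add: abs_divide divide_le_eq mult.commute)
    moreover have "\<psi> b - \<psi> a = ((\<phi> b - \<phi> a) / K + (b - a)) / 2"
      using K by (simp add: \<psi>_def field_simps)
    ultimately show "0 \<le> \<psi> b - \<psi> a \<and> \<psi> b - \<psi> a \<le> b - a"
      unfolding abs_le_iff by argo
  qed
  moreover have "\<exists>c. (\<phi> has_real_derivative c) (at x)" if "(\<psi> has_real_derivative c) (at x)" for x c
  proof -
    have "\<phi> = (\<lambda>x. K * (2 * \<psi> x - x))" using K by (auto simp: \<psi>_def field_simps)
    moreover have "((\<lambda>x. K * (2 * \<psi> x - x)) has_real_derivative K * (2 * c - 1)) (at x)"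
      using that by (auto intro!: derivative_eq_intros)
    ultimately show ?thesis by auto
  qed
  ultimately show ?thesis by (elim AE_mp) (intro AE_I2 impI, blast)
qed

text \<open>
  McShane's extension by an infimum of cones.
\<close>

lemma lipschitz_extension_real:
  fixes f :: "'a::metric_space \<Rightarrow> real"
  assumes lip: "L-lipschitz_on K f"
  obtains g where "L-lipschitz_on UNIV g" "\<And>x. x \<in> K \<Longrightarrow> g x = f x"
proof (cases "K = {}")
  case True
  have "L-lipschitz_on UNIV (\<lambda>x::'a. 0::real)"
    using lipschitz_on_nonneg[OF lip] by (intro lipschitz_onI) auto
  then show ?thesis using that True by blast
next
  case False
  have L: "0 \<le> L" using lip by (rule lipschitz_on_nonneg)
  define g where "g x = (INF k\<in>K. f k + L * dist x k)" for x
  have bdd: "bdd_below ((\<lambda>k. f k + L * dist x k) ` K)" for x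
  proof -
    obtain k0 where "k0 \<in> K" using False by blast
    have "f k0 - L * dist x k0 \<le> f k + L * dist x k" if "k \<in> K" for k
    proof -
      have "f k0 - f k \<le> L * dist k0 k"
        using lipschitz_onD[OF lip \<open>k0 \<in> K\<close> that] by (auto simp: dist_real_def)
      also have "\<dots> \<le> L * (dist x k0 + dist x k)"
        using L by (intro mult_left_mono) (auto simp: dist_triangle2 dist_commute[of x])
      finally show ?thesis by (simp add: algebra_simps)
    qed
    then show ?thesis by (intro bdd_belowI2)
  qed
  have le: "g x \<le> g y + L * dist x y" for x y
  proof -
    have "g x - L * dist x y \<le> g y"
      unfolding g_def[of y]
    proof (rule cINF_greatest[OF False])
      fix k assume "k \<in> K"
      have "g x \<le> f k + L * dist x k" unfolding g_def using bdd \<open>k \<in> K\<close> by (rule cINF_lower)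
      also have "\<dots> \<le> f k + L * (dist x y + dist y k)"
        using L by (intro add_left_mono mult_left_mono dist_triangle)
      finally show "g x - L * dist x y \<le> f k + L * dist y k" by (simp add: algebra_simps)
    qed
    then show ?thesis by simp
  qed
  have "L-lipschitz_on UNIV g"
  proof (rule lipschitz_onI)
    show "dist (g x) (g y) \<le> L * dist x y" for x y
      using le[of x y] le[of y x] by (auto simp: dist_real_def abs_le_iff dist_commute[of y])
  qed (rule L)
  moreover have "g x = f x" if "x \<in> K" for x
  proof (rule antisym)
    show "g x \<le> f x" unfolding g_def using cINF_lower[OF bdd that, of x] by simp
    show "f x \<le> g x" unfolding g_def
    proof (rule cINF_greatest[OF False])
      fix k assume "k \<in> K"
      show "f x \<le> f k + L * dist x k"
        using lipschitz_onD[OF lip that \<open>k \<in> K\<close>] by (auto simp: dist_real_def)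
    qed
  qed
  ultimately show ?thesis using that by blast
qed

section \<open>Boundary derivatives and nontangential limits\<close>

text \<open>
  Wedges are truncated and of one fixed aperture, and serve to state bounds; Stolz regions have every
  aperture, and serve to state limits at their vertex, where only their germ matters.
\<close>

definition wedge :: "real \<Rightarrow> real \<Rightarrow> complex set" where
  "wedge x h = {z. \<bar>Re z - x\<bar> < Im z \<and> Im z < h}"

definition stolz :: "real \<Rightarrow> real \<Rightarrow> complex set" where
  "stolz \<eta> x = {z. \<eta> * cmod (z - of_real x) < Im z}"

text \<open>
  An explicit substitute for the harmonic measure of the bottom side of the box
  \<open>\<bar>Re q\<bar> \<le> 1\<close>, \<open>0 \<le> Im q \<le> 1/2\<close>: the real part is at most 1 on the bottom side, at most 0 on the
  other sides, and at least 1/2 near the middle of the bottom side.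
\<close>

definition box_potential :: "complex \<Rightarrow> complex" where
  "box_potential q = 1 - 2 * q\<^sup>2 + 4 * \<i> * q"

lemma Re_box_potential: "Re (box_potential q) = 1 - 2 * (Re q)\<^sup>2 + 2 * (Im q)\<^sup>2 - 4 * Im q"
  by (simp add: box_potential_def power2_eq_square)

lemma box_potential_le_1:
  assumes "0 \<le> Im q" "Im q \<le> 1/2" shows "Re (box_potential q) \<le> 1"
proof -
  have "(Im q)\<^sup>2 \<le> (1/2) * Im q" unfolding power2_eq_square by (rule mult_right_mono[OF assms(2,1)])
  moreover have "0 \<le> (Re q)\<^sup>2" by simp
  ultimately show ?thesis using assms unfolding Re_box_potential by linarith
qed

lemma box_potential_le_0:
  assumes "0 \<le> Im q" "Im q \<le> 1/2" "\<bar>Re q\<bar> = 1 \<or> Im q = 1/2" shows "Re (box_potential q) \<le> 0"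
  using assms(3)
proof
  assume "\<bar>Re q\<bar> = 1"
  then have "(Re q)\<^sup>2 = 1" by (metis power2_abs power_one)
  moreover have "(Im q)\<^sup>2 \<le> (1/2) * Im q" unfolding power2_eq_square by (rule mult_right_mono[OF assms(2,1)])
  ultimately show ?thesis using assms unfolding Re_box_potential by linarith
next
  assume q: "Im q = 1/2"
  have "(Im q)\<^sup>2 = 1/4" unfolding q by (simp add: power2_eq_square)
  moreover have "0 \<le> (Re q)\<^sup>2" by simp
  ultimately show ?thesis unfolding Re_box_potential using q by linarith
qed

lemma box_potential_ge_half:
  assumes "0 \<le> Im q" "Im q \<le> 1/16" "\<bar>Re q\<bar> \<le> 1/16" shows "1/2 \<le> Re (box_potential q)"
proof -
  have "(Re q)\<^sup>2 \<le> (1/16)\<^sup>2" using assms by (metis abs_ge_zero power2_abs power_mono)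
  then have "(Re q)\<^sup>2 \<le> 1/256" by (simp add: power2_eq_square)
  moreover have "0 \<le> (Im q)\<^sup>2" by simp
  ultimately show ?thesis using assms unfolding Re_box_potential by linarith
qed

lemma holomorphic_box_potential [holomorphic_intros]:
  "g holomorphic_on S \<Longrightarrow> (\<lambda>z. box_potential (g z)) holomorphic_on S"
  unfolding box_potential_def by (intro holomorphic_intros)

text \<open>
  A two-constants theorem for a box: half of the exponential gain on the bottom side survives in the
  lower middle part.
\<close>

lemma two_constants_box:
  fixes f :: "complex \<Rightarrow> complex" and p :: complex
  assumes hol: "f holomorphic_on S" and "open S" and "0 < T"
    and sub: "\<And>z. \<bar>Re z - Re p\<bar> \<le> T \<Longrightarrow> Im p \<le> Im z \<Longrightarrow> Im z \<le> Im p + T/2 \<Longrightarrow> z \<in> S \<and> cmod (f z) \<le> A"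
    and bottom: "\<And>z. \<bar>Re z - Re p\<bar> \<le> T \<Longrightarrow> Im z = Im p \<Longrightarrow> cmod (f z) \<le> A * exp (- N)"
    and "0 \<le> N"
    and z: "\<bar>Re z - Re p\<bar> \<le> T/16" "Im p \<le> Im z" "Im z \<le> Im p + T/16"
  shows "cmod (f z) \<le> A * exp (- N / 2)"
proof -
  define Q where "Q = cbox (Complex (Re p - T) (Im p)) (Complex (Re p + T) (Im p + T/2))"
  define q where "q z = (z - p) / of_real T" for z
  \<comment> \<open>The factor compensates the gain \<open>exp (- N)\<close> on the bottom and is at most 1 in modulus on the other sides.\<close>
  define g where "g z = f z * exp (of_real N * box_potential (q z))" for z
  have Q: "w \<in> Q \<longleftrightarrow> \<bar>Re w - Re p\<bar> \<le> T \<and> Im p \<le> Im w \<and> Im w \<le> Im p + T/2" for w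
    by (auto simp: Q_def in_cbox_complex_iff abs_le_iff)
  have intQ: "w \<in> interior Q \<longleftrightarrow> \<bar>Re w - Re p\<bar> < T \<and> Im p < Im w \<and> Im w < Im p + T/2" for w
    by (auto simp: Q_def in_box_complex_iff interior_cbox abs_less_iff)
  have Req: "Re (q w) = (Re w - Re p) / T" and Imq: "Im (q w) = (Im w - Im p) / T" for w
    using \<open>0 < T\<close> by (simp_all add: q_def Re_divide_of_real Im_divide_of_real)
  have QS: "Q \<subseteq> S" using sub Q by blast
  have holg: "g holomorphic_on S" unfolding g_def q_def
    using hol \<open>0 < T\<close> by (intro holomorphic_intros) auto
  have normg: "cmod (g w) = cmod (f w) * exp (N * Re (box_potential (q w)))" for w
    by (simp add: g_def norm_mult)
  have A: "0 \<le> A" using sub[of p] \<open>0 < T\<close> by (auto intro: order_trans[OF norm_ge_zero])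
  have "cmod (g z) \<le> A"
  proof (rule maximum_modulus_frontier[where f = g and S = Q])
    show "g holomorphic_on interior Q"
      using holg QS interior_subset by (meson holomorphic_on_subset order_trans)
    show "continuous_on (closure Q) g"
      using holg QS by (metis Q_def closed_cbox closure_closed holomorphic_on_imp_continuous_on holomorphic_on_subset)
    show "bounded Q" unfolding Q_def by (rule bounded_cbox)
    show "z \<in> Q" using z \<open>0 < T\<close> by (auto simp: Q)
    fix w assume "w \<in> frontier Q"
    then have w: "w \<in> Q" "w \<notin> interior Q" by (auto simp: frontier_def Q_def)
    then have wQ: "\<bar>Re w - Re p\<bar> \<le> T" "Im p \<le> Im w" "Im w \<le> Im p + T/2" by (auto simp: Q)
    have q0: "0 \<le> Im (q w)" "Im (q w) \<le> 1/2"
      using wQ \<open>0 < T\<close> by (auto simp: Imq field_simps)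
    show "cmod (g w) \<le> A"
    proof (cases "Im w = Im p")
      case True
      have "cmod (g w) \<le> A * exp (- N) * exp (N * 1)"
        unfolding normg using bottom[of w] wQ True box_potential_le_1[OF q0] \<open>0 \<le> N\<close> A
        by (intro mult_mono) (auto intro!: mult_left_le)
      then show ?thesis by (simp add: mult.assoc flip: exp_add)
    next
      case False
      then have "\<bar>Re w - Re p\<bar> = T \<or> Im w = Im p + T/2"
        using w wQ by (auto simp: intQ)
      then have "\<bar>Re (q w)\<bar> = 1 \<or> Im (q w) = 1/2"
        using \<open>0 < T\<close> by (auto simp: Req Imq abs_divide)
      then have "N * Re (box_potential (q w)) \<le> 0"
        using box_potential_le_0[OF q0] \<open>0 \<le> N\<close> by (simp add: mult_nonneg_nonpos)
      then have "cmod (g w) \<le> A * 1"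
        unfolding normg using sub[OF wQ] A by (intro mult_mono) auto
      then show ?thesis by simp
    qed
  qed
  moreover have "exp (N/2) \<le> exp (N * Re (box_potential (q z)))"
  proof -
    have "1/2 \<le> Re (box_potential (q z))"
      using z \<open>0 < T\<close> by (intro box_potential_ge_half) (auto simp: Req Imq abs_divide field_simps)
    then have "N * (1/2) \<le> N * Re (box_potential (q z))" using \<open>0 \<le> N\<close> by (rule mult_left_mono)
    then show ?thesis by simp
  qed
  ultimately have "cmod (f z) * exp (N/2) \<le> A"
    unfolding normg by (meson mult_left_mono norm_ge_zero order_trans)
  then show ?thesis
    by (simp add: exp_minus field_simps)
qed

lemma infdist_less_imp_near:
  assumes "infdist x K < e" "K \<noteq> {}"
  obtains k where "k \<in> K" "dist x k < e"
proof -
  have "Inf ((\<lambda>a. dist x a) ` K) < e" using assms(1) unfolding infdist_notempty[OF assms(2)] .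
  then obtain y where "y \<in> (\<lambda>a. dist x a) ` K" "y < e"
    using assms(2) by (meson cInf_lessD image_is_empty)
  then show thesis using that by blast
qed

text \<open>
  The boundary function \<open>\<phi>\<close> of the primitive \<open>F\<close> has a derivative \<open>c\<close> at \<open>x0\<close> along \<open>K\<close>, and \<open>K\<close> has no
  proportionally large gaps near \<open>x0\<close>. At scale \<open>\<delta>\<close> around \<open>x0\<close> the error \<open>R\<close> of the linear approximation
  of \<open>F\<close> is then \<open>O(\<delta>)\<close> in a box that reaches almost down to the real line, and \<open>o(\<delta>)\<close> on its bottom side.
  The two-constants estimate makes \<open>R\<close> of size \<open>o(\<delta>)\<close> at distance \<open>\<delta>\<close> within every Stolz region, and Cauchy's
  inequality turns this into \<open>R' = G - c \<longlongrightarrow> 0\<close>.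
\<close>

lemma nontangential_limit_at_boundary_derivative:
  fixes F G :: "complex \<Rightarrow> complex" and \<phi> :: "real \<Rightarrow> complex"
  assumes dF: "\<And>z. 0 < Im z \<Longrightarrow> (F has_field_derivative G z) (at z)"
    and bnd: "\<And>x z. x \<in> K \<Longrightarrow> z \<in> wedge x h \<Longrightarrow> cmod (F z - \<phi> x) \<le> M * cmod (z - of_real x)"
    and "0 < h" "x0 \<in> K"
    and der: "\<And>e. 0 < e \<Longrightarrow> \<exists>d>0. \<forall>x\<in>K. \<bar>x - x0\<bar> < d \<longrightarrow>
        cmod (\<phi> x - \<phi> x0 - c * of_real (x - x0)) \<le> e * \<bar>x - x0\<bar>"
    and dense: "\<And>e. 0 < e \<Longrightarrow> \<exists>d>0. \<forall>s. \<bar>s - x0\<bar> < d \<longrightarrow> infdist s K \<le> e * \<bar>s - x0\<bar>"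
    and "0 < \<eta>"
  shows "(G \<longlongrightarrow> c) (at (of_real x0) within stolz \<eta> x0)"
  unfolding tendsto_iff
proof (intro allI impI)
  fix \<epsilon> :: real assume "0 < \<epsilon>"
  define C where "C = 2 * \<bar>M\<bar> + 2 * cmod c + 2"
  have C: "0 < C" unfolding C_def by (intro add_nonneg_pos) auto
  \<comment> \<open>The final bound for \<open>G - c\<close> is \<open>34 * C * t / \<eta>\<close>. The box starts at height \<open>\<tau> * \<delta>\<close>; since the
    two-constants estimate takes a square root, \<open>\<tau>\<close> is the square of \<open>t\<close>.\<close>
  define t where "t = min 1 (min (\<eta>/2) (\<epsilon> * \<eta> / (68 * C)))"
  have t: "0 < t" "t \<le> 1" "t \<le> \<eta>/2" "t \<le> \<epsilon> * \<eta> / (68 * C)"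
    using \<open>0 < \<eta>\<close> \<open>0 < \<epsilon>\<close> C by (auto simp: t_def)
  define \<tau> where "\<tau> = t\<^sup>2"
  have \<tau>: "0 < \<tau>" "\<tau> \<le> t" "\<tau> \<le> 1" 
    using t by (auto simp: \<tau>_def power2_eq_square mult_le_one mult_left_le)
  obtain d1 where d1: "d1 > 0" "\<And>x. x \<in> K \<Longrightarrow> \<bar>x - x0\<bar> < d1 \<Longrightarrow>
        cmod (\<phi> x - \<phi> x0 - c * of_real (x - x0)) \<le> \<tau>/64 * \<bar>x - x0\<bar>"
    using der[of "\<tau>/64"] \<tau> by auto
  obtain d2 where d2: "d2 > 0" "\<And>s. \<bar>s - x0\<bar> < d2 \<Longrightarrow> infdist s K \<le> \<tau>/64 * \<bar>s - x0\<bar>"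
    using dense[of "\<tau>/64"] \<tau> by auto
  define \<rho> where "\<rho> = min (min d1 d2) h / 40"
  have \<rho>: "0 < \<rho>" "40 * \<rho> \<le> d1" "40 * \<rho> \<le> d2" "40 * \<rho> \<le> h"
    using d1 d2 \<open>0 < h\<close> by (auto simp: \<rho>_def)
  have main: "cmod (G z - c) < \<epsilon>" if zs: "z \<in> stolz \<eta> x0" and z0: "z \<noteq> of_real x0" and zr: "cmod (z - of_real x0) < \<rho>" for z
  proof -
    define \<delta> where "\<delta> = cmod (z - of_real x0)"
    have \<delta>: "0 < \<delta>" "\<delta> < \<rho>" "\<eta> * \<delta> < Im z"
      using zs z0 zr by (auto simp: \<delta>_def stolz_def)
    have Rez: "\<bar>Re z - x0\<bar> \<le> \<delta>" and Imz: "\<bar>Im z\<bar> \<le> \<delta>"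
      using abs_Re_le_cmod[of "z - of_real x0"] abs_Im_le_cmod[of "z - of_real x0"] by (auto simp: \<delta>_def)
    have \<eta>1: "\<eta> < 1"
    proof -
      have "\<eta> * \<delta> < 1 * \<delta>" using \<delta> Imz by linarith
      then show ?thesis using \<delta>(1) by (simp only: mult_less_cancel_right_pos)
    qed
    have \<tau>\<delta>: "0 < \<tau> * \<delta>" "\<tau> * \<delta> \<le> \<delta>"
      using \<tau> \<delta> by (auto simp: mult_le_cancel_right1)
    \<comment> \<open>The error of the linear approximation of \<open>F\<close>; its derivative is the quantity to be estimated.\<close>
    define R where "R \<zeta> = F \<zeta> - \<phi> x0 - c * (\<zeta> - of_real x0)" for \<zeta>
    have dR: "(R has_field_derivative G \<zeta> - c) (at \<zeta>)" if "0 < Im \<zeta>" for \<zeta>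
      unfolding R_def by (rule derivative_eq_intros dF[OF that] refl | simp)+
    define H where "H = {z. 0 < Im z}"
    have "open H" unfolding H_def by (rule open_halfspace_Im_gt)
    have holR: "R holomorphic_on H"
      using dR by (auto simp: H_def holomorphic_on_def field_differentiable_def intro: has_field_derivative_at_within)
    \<comment> \<open>Every point of the box lies in the wedge over some point \<open>x1\<close> of \<open>K\<close>, as the gaps of \<open>K\<close> near \<open>x0\<close>
      are short compared with \<open>\<tau> * \<delta>\<close>; \<open>R\<close> is small at \<open>x1\<close> and Lipschitz in that wedge.\<close>
    have est: "cmod (R \<zeta>) \<le> C * Im \<zeta>"
      if \<zeta>: "\<bar>Re \<zeta> - x0\<bar> \<le> 32 * \<delta>" "\<tau> * \<delta> \<le> Im \<zeta>" "Im \<zeta> \<le> \<tau> * \<delta> + 16 * \<delta>" for \<zeta>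
    proof -
      have "infdist (Re \<zeta>) K \<le> \<tau>/64 * \<bar>Re \<zeta> - x0\<bar>"
        using \<zeta> \<delta> \<rho> by (intro d2(2)) auto
      also have "\<dots> \<le> \<tau>/64 * (32 * \<delta>)" using \<zeta> \<tau> by (intro mult_left_mono) auto
      also have "\<dots> < \<tau> * \<delta>" using \<tau>\<delta> by linarith
      finally have "infdist (Re \<zeta>) K < \<tau> * \<delta>" .
      moreover have "K \<noteq> {}" using \<open>x0 \<in> K\<close> by blast
      ultimately obtain x1 where x1: "x1 \<in> K" "dist (Re \<zeta>) x1 < \<tau> * \<delta>"
        by (rule infdist_less_imp_near)
      have x1d: "\<bar>Re \<zeta> - x1\<bar> < \<tau> * \<delta>" using x1 by (simp add: dist_real_def)
      have "\<bar>Re \<zeta> - x1\<bar> < Im \<zeta>" "Im \<zeta> < h" using x1d \<zeta> \<tau>\<delta> \<delta> \<rho> by linarith+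
      then have "\<zeta> \<in> wedge x1 h" by (simp add: wedge_def)
      then have 1: "cmod (F \<zeta> - \<phi> x1) \<le> M * cmod (\<zeta> - of_real x1)" by (rule bnd[OF x1(1)])
      have x10: "\<bar>x1 - x0\<bar> \<le> 33 * \<delta>" using x1d \<zeta> \<tau>\<delta> by linarith
      have "cmod (\<phi> x1 - \<phi> x0 - c * of_real (x1 - x0)) \<le> \<tau>/64 * \<bar>x1 - x0\<bar>"
        using x10 \<delta> \<rho> by (intro d1(2)[OF x1(1)]) auto
      also have "\<dots> \<le> \<tau>/64 * (33 * \<delta>)" using x10 \<tau> by (intro mult_left_mono) auto
      also have "\<dots> \<le> Im \<zeta>" using \<tau>\<delta> \<zeta> by linarith
      finally have 2: "cmod (\<phi> x1 - \<phi> x0 - c * of_real (x1 - x0)) \<le> Im \<zeta>" .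
      have "cmod (\<zeta> - of_real x1) \<le> \<bar>Re \<zeta> - x1\<bar> + \<bar>Im \<zeta>\<bar>"
        using cmod_le[of "\<zeta> - of_real x1"] by simp
      then have 3: "cmod (\<zeta> - of_real x1) \<le> 2 * Im \<zeta>" using x1d \<zeta> \<tau>\<delta> by linarith
      have "R \<zeta> = (F \<zeta> - \<phi> x1) + (\<phi> x1 - \<phi> x0 - c * of_real (x1 - x0)) - c * (\<zeta> - of_real x1)"
        by (simp add: R_def algebra_simps)
      then have "cmod (R \<zeta>) \<le> cmod (F \<zeta> - \<phi> x1) + cmod (\<phi> x1 - \<phi> x0 - c * of_real (x1 - x0)) + cmod c * cmod (\<zeta> - of_real x1)"
        by (simp only:) (rule order_trans[OF norm_triangle_ineq4], rule add_mono[OF norm_triangle_ineq], simp add: norm_mult)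
      also have "\<dots> \<le> \<bar>M\<bar> * (2 * Im \<zeta>) + Im \<zeta> + cmod c * (2 * Im \<zeta>)"
      proof -
        have "M * cmod (\<zeta> - of_real x1) \<le> \<bar>M\<bar> * (2 * Im \<zeta>)"
          using 3 by (intro mult_mono) auto
        moreover have "cmod c * cmod (\<zeta> - of_real x1) \<le> cmod c * (2 * Im \<zeta>)"
          using 3 by (intro mult_left_mono) auto
        ultimately show ?thesis using 1 2 by linarith
      qed
      also have "\<dots> \<le> C * Im \<zeta>" using \<zeta> \<tau>\<delta> by (simp add: C_def algebra_simps)
      finally show ?thesis .
    qed
    have small: "cmod (R \<zeta>) \<le> 17 * C * \<delta> * t" if \<zeta>: "cmod (\<zeta> - z) \<le> \<eta> * \<delta> / 2" for \<zeta>
    proof -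
      define p where "p = Complex x0 (\<tau> * \<delta>)"
      have half: "\<eta> * \<delta> \<le> \<delta>" using \<eta>1 \<delta> by (simp add: mult_le_cancel_right1)
      have t\<delta>: "\<tau> * \<delta> \<le> \<eta>/2 * \<delta>" using \<tau> t \<delta> by (intro mult_right_mono) auto
      have Re\<zeta>: "\<bar>Re \<zeta> - Re z\<bar> \<le> \<eta> * \<delta> / 2" and Im\<zeta>: "\<bar>Im \<zeta> - Im z\<bar> \<le> \<eta> * \<delta> / 2"
        using abs_Re_le_cmod[of "\<zeta> - z"] abs_Im_le_cmod[of "\<zeta> - z"] \<zeta> by auto
      have "cmod (R \<zeta>) \<le> (17 * C * \<delta>) * exp (- (-2 * ln t) / 2)"
      proof (rule two_constants_box[OF holR \<open>open H\<close>, of "32 * \<delta>" p])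
        show "\<bar>Re \<zeta> - Re p\<bar> \<le> 32 * \<delta> / 16" "Im p \<le> Im \<zeta>" "Im \<zeta> \<le> Im p + 32 * \<delta> / 16"
        proof -
          have "\<bar>Re \<zeta> - x0\<bar> \<le> 2 * \<delta>" "\<tau> * \<delta> \<le> Im \<zeta>" "Im \<zeta> \<le> \<tau> * \<delta> + 2 * \<delta>"
            using Re\<zeta> Im\<zeta> Rez Imz half t\<delta> \<delta> \<tau>\<delta> by linarith+
          then show "\<bar>Re \<zeta> - Re p\<bar> \<le> 32 * \<delta> / 16" "Im p \<le> Im \<zeta>" "Im \<zeta> \<le> Im p + 32 * \<delta> / 16"
            by (simp_all add: p_def)
        qed
        show "0 \<le> - 2 * ln t" using t by simp
        show "0 < 32 * \<delta>" using \<delta> by simp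
      next
        fix w assume w: "\<bar>Re w - Re p\<bar> \<le> 32 * \<delta>" "Im w = Im p"
        then have "cmod (R w) \<le> C * (\<tau> * \<delta>)" using est[of w] \<delta> by (simp add: p_def)
        also have "\<dots> \<le> 17 * C * \<delta> * \<tau>" using C \<tau>\<delta> \<tau>(1) \<delta>(1) by simp
        also have "\<tau> = exp (- (- 2 * ln t))" using t exp_double[of "ln t"] by (simp add: \<tau>_def)
        finally show "cmod (R w) \<le> 17 * C * \<delta> * exp (- (- 2 * ln t))" .
      next
        fix w assume w: "\<bar>Re w - Re p\<bar> \<le> 32 * \<delta>" "Im p \<le> Im w" "Im w \<le> Im p + 32 * \<delta> / 2"
        then have "cmod (R w) \<le> C * Im w" using est[of w] by (simp add: p_def)
        also have "\<dots> \<le> C * (17 * \<delta>)" using w \<tau>\<delta> C by (intro mult_left_mono) (auto simp: p_def)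
        finally show "w \<in> H \<and> cmod (R w) \<le> 17 * C * \<delta>"
          using w \<tau>\<delta> by (simp add: H_def p_def)
      qed
      then show ?thesis using t by simp
    qed
    have r0: "0 < \<eta> * \<delta> / 2" using \<open>0 < \<eta>\<close> \<delta> by simp
    have sub: "cball z (\<eta> * \<delta> / 2) \<subseteq> H"
    proof
      fix w assume "w \<in> cball z (\<eta> * \<delta> / 2)"
      then have "\<bar>Im w - Im z\<bar> \<le> \<eta> * \<delta> / 2"
        using abs_Im_le_cmod[of "w - z"] by (auto simp: dist_norm norm_minus_commute)
      then have "0 < Im w" using \<delta>(3) r0 by linarith
      then show "w \<in> H" by (simp add: H_def)
    qed
    have "cmod ((deriv ^^ 1) R z) \<le> fact 1 * (17 * C * \<delta> * t) / (\<eta> * \<delta> / 2) ^ 1"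
    proof (rule Cauchy_inequality)
      show "R holomorphic_on ball z (\<eta> * \<delta> / 2)"
        using holR sub by (meson ball_subset_cball holomorphic_on_subset order_trans)
      show "continuous_on (cball z (\<eta> * \<delta> / 2)) R"
        using holR sub by (meson holomorphic_on_imp_continuous_on holomorphic_on_subset)
      show "cmod (R w) \<le> 17 * C * \<delta> * t" if "cmod (z - w) = \<eta> * \<delta> / 2" for w
        using that small[of w] by (simp add: norm_minus_commute)
    qed (rule r0)
    moreover have "deriv R z = G z - c"
      using dR[of z] \<delta> r0 by (intro DERIV_imp_deriv) simp
    ultimately have "cmod (G z - c) \<le> 17 * C * \<delta> * t / (\<eta> * \<delta> / 2)" by simp
    also have "\<dots> = 34 * C / \<eta> * t" using \<delta> by (simp add: field_simps)
    also have "\<dots> \<le> 34 * C / \<eta> * (\<epsilon> * \<eta> / (68 * C))"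
      using t C \<open>0 < \<eta>\<close> by (intro mult_left_mono) auto
    also have "\<dots> = \<epsilon> / 2" using C \<open>0 < \<eta>\<close> by (simp add: field_simps)
    finally show ?thesis using \<open>0 < \<epsilon>\<close> by simp
  qed
  show "\<forall>\<^sub>F z in at (of_real x0) within stolz \<eta> x0. dist (G z) c < \<epsilon>"
    unfolding eventually_at using main \<rho>(1)
    by (intro exI[of _ \<rho>]) (auto simp: dist_norm)
qed

section \<open>A local Fatou theorem\<close>

lemma wedge_subset_halfplane: "wedge x h \<subseteq> {z. 0 < Im z}"
  by (auto simp: wedge_def)

lemma convex_wedge: "convex (wedge x h)"
proof -
  have "wedge x h = {z. inner (Complex 1 (-1)) z < x} \<inter> {z. inner (Complex (-1) (-1)) z < -x} \<inter> {z. inner \<i> z < h}"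
    by (auto simp: wedge_def inner_complex_def abs_less_iff)
  then show ?thesis by (simp only:) (intro convex_Int convex_halfspace_lt)
qed

text \<open>
  A primitive of a function that is bounded on wedges is Lipschitz in every single wedge, which yields its
  boundary value at the vertex. Two overlapping wedges compare the boundary values at their vertices.
\<close>

lemma primitive_boundary_values:
  fixes F G :: "complex \<Rightarrow> complex"
  assumes dF: "\<And>z. 0 < Im z \<Longrightarrow> (F has_field_derivative G z) (at z)"
    and bound: "\<And>x z. x \<in> K \<Longrightarrow> z \<in> wedge x h \<Longrightarrow> cmod (G z) \<le> M"
    and "0 < h"
  obtains \<phi> :: "real \<Rightarrow> complex" where
    "\<And>x z. x \<in> K \<Longrightarrow> z \<in> wedge x h \<Longrightarrow> cmod (F z - \<phi> x) \<le> M * cmod (z - of_real x)"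
    "\<And>x y. x \<in> K \<Longrightarrow> y \<in> K \<Longrightarrow> \<bar>x - y\<bar> < h \<Longrightarrow> cmod (\<phi> x - \<phi> y) \<le> 3 * M * \<bar>x - y\<bar>"
proof -
  have lipF: "cmod (F z - F w) \<le> M * cmod (z - w)" if "x \<in> K" "z \<in> wedge x h" "w \<in> wedge x h" for x z w
  proof (rule field_differentiable_bound[OF convex_wedge])
    show "(F has_field_derivative G u) (at u within wedge x h)" if "u \<in> wedge x h" for u
      using that wedge_subset_halfplane by (intro has_field_derivative_at_within[OF dF]) auto
  qed (use that bound in auto)
  define p where "p x n = Complex x (h / real (n + 2))" for x n
  have p: "p x n \<in> wedge x h" for x n
  proof -
    have "h * 1 < h * real (n + 2)" using \<open>0 < h\<close> by (intro mult_strict_left_mono) auto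
    then have "h / real (n + 2) < h" by (simp add: divide_less_eq)
    moreover have "0 < h / real (n + 2)" using \<open>0 < h\<close> by simp
    ultimately show ?thesis by (simp add: p_def wedge_def)
  qed
  have plim: "(\<lambda>n. p x n) \<longlonglongrightarrow> of_real x" for x
  proof -
    have "(\<lambda>n. h / real (n + 2)) \<longlonglongrightarrow> 0"
      by (rule LIMSEQ_ignore_initial_segment[OF lim_const_over_n])
    then have "(\<lambda>n. Complex x (h / real (n + 2))) \<longlonglongrightarrow> Complex x 0"
      by (intro tendsto_Complex tendsto_const)
    then show ?thesis by (simp add: p_def complex_of_real_def)
  qed
  have conv: "convergent (\<lambda>n. F (p x n))" if "x \<in> K" for x
  proof -
    have lip: "\<bar>M\<bar>-lipschitz_on (wedge x h) F"
    proof (rule lipschitz_onI)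
      fix z w assume "z \<in> wedge x h" "w \<in> wedge x h"
      then have "cmod (F z - F w) \<le> M * cmod (z - w)" using lipF[OF that] by simp
      also have "\<dots> \<le> \<bar>M\<bar> * cmod (z - w)" by (intro mult_right_mono) auto
      finally show "dist (F z) (F w) \<le> \<bar>M\<bar> * dist z w" by (simp add: dist_norm)
    qed simp
    have "Cauchy (\<lambda>n. F (p x n))"
      by (rule uniformly_continuous_on_Cauchy[OF lipschitz_on_uniformly_continuous[OF lip] LIMSEQ_imp_Cauchy[OF plim] p])
    then show ?thesis by (simp add: Cauchy_convergent_iff)
  qed
  define \<phi> where "\<phi> x = lim (\<lambda>n. F (p x n))" for x
  have lim: "(\<lambda>n. F (p x n)) \<longlonglongrightarrow> \<phi> x" if "x \<in> K" for x
    using conv[OF that] by (simp add: \<phi>_def convergent_LIMSEQ_iff)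
  have near: "cmod (F z - \<phi> x) \<le> M * cmod (z - of_real x)" if "x \<in> K" "z \<in> wedge x h" for x z
  proof (rule LIMSEQ_le)
    show "(\<lambda>n. cmod (F z - F (p x n))) \<longlonglongrightarrow> cmod (F z - \<phi> x)"
      by (intro tendsto_intros lim that)
    show "(\<lambda>n. M * cmod (z - p x n)) \<longlonglongrightarrow> M * cmod (z - of_real x)"
      by (intro tendsto_intros plim)
    show "\<exists>N. \<forall>n\<ge>N. cmod (F z - F (p x n)) \<le> M * cmod (z - p x n)"
      using lipF[OF that p] by blast
  qed
  moreover have "cmod (\<phi> x - \<phi> y) \<le> 3 * M * \<bar>x - y\<bar>" if "x \<in> K" "y \<in> K" "\<bar>x - y\<bar> < h" for x y
  proof (cases "x = y")
    case False
    \<comment> \<open>A point common to both wedges whose distances to \<open>x\<close> and \<open>y\<close> are comparable to \<open>\<bar>x - y\<bar>\<close>.\<close>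
    define z where "z = Complex ((x + y) / 2) \<bar>x - y\<bar>"
    have "z \<in> wedge x h" "z \<in> wedge y h"
      using False that by (auto simp: z_def wedge_def field_simps abs_if)
    then have n: "cmod (F z - \<phi> x) \<le> M * cmod (z - of_real x)" "cmod (F z - \<phi> y) \<le> M * cmod (z - of_real y)"
      using near that by auto
    have "0 \<le> M" using bound[OF that(1) \<open>z \<in> wedge x h\<close>] by (meson norm_ge_zero order_trans)
    have c: "cmod (z - of_real x) \<le> 3/2 * \<bar>x - y\<bar>" "cmod (z - of_real y) \<le> 3/2 * \<bar>x - y\<bar>"
      using cmod_le[of "z - of_real x"] cmod_le[of "z - of_real y"]
      by (auto simp: z_def abs_if field_simps split: if_splits)
    have "cmod (\<phi> x - \<phi> y) \<le> cmod (F z - \<phi> x) + cmod (F z - \<phi> y)"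
      by (metis dist_commute dist_norm dist_triangle)
    also have "\<dots> \<le> M * (3/2 * \<bar>x - y\<bar>) + M * (3/2 * \<bar>x - y\<bar>)"
      using n mult_left_mono[OF c(1) \<open>0 \<le> M\<close>] mult_left_mono[OF c(2) \<open>0 \<le> M\<close>] by linarith
    finally show ?thesis by simp
  qed simp
  ultimately show thesis by (rule that)
qed

lemma real_derivative_error:
  fixes f :: "real \<Rightarrow> real"
  assumes "(f has_real_derivative D) (at a)" "0 < e"
  shows "\<exists>d>0. \<forall>x. \<bar>x - a\<bar> < d \<longrightarrow> \<bar>f x - f a - D * (x - a)\<bar> \<le> e * \<bar>x - a\<bar>"
proof -
  have "(f has_derivative (\<lambda>h. D * h)) (at a)" using assms(1) by (simp add: has_field_derivative_def)
  then show ?thesis using assms(2) unfolding has_derivative_at_alt by (auto simp: abs_minus_commute)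
qed

text \<open>
  The distance to \<open>K\<close> is minimal at \<open>a\<close>. Being Lipschitz, it is differentiable almost everywhere, so near
  almost every point of \<open>K\<close> the gaps of \<open>K\<close> are short in proportion to their distance from that point; the
  density theorem is used in this form.
\<close>

lemma infdist_real_derivative_0:
  assumes "((\<lambda>s. infdist s K) has_real_derivative D) (at a)" "a \<in> K"
  shows "D = 0"
  using assms by (intro DERIV_local_min[OF assms(1), of 1]) (auto simp: infdist_nonneg)

text \<open>
  Almost every point of \<open>K\<close> is a point of differentiability both for a Lipschitz extension of the
  boundary values of a primitive and for the distance to \<open>K\<close>.
\<close>

lemma local_fatou:
  fixes G :: "complex \<Rightarrow> complex"
  assumes hol: "G holomorphic_on {z. 0 < Im z}"
    and bound: "\<And>x z. x \<in> K \<Longrightarrow> z \<in> wedge x h \<Longrightarrow> cmod (G z) \<le> M"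
    and "0 < h"
  shows "AE x in lborel. x \<in> K \<longrightarrow> (\<exists>c. \<forall>\<eta>>0. (G \<longlongrightarrow> c) (at (of_real x) within stolz \<eta> x))"
proof -
  let ?H = "{z. 0 < Im z}"
  obtain F where F: "\<And>z. 0 < Im z \<Longrightarrow> (F has_field_derivative G z) (at z)"
  proof (rule holomorphic_convex_primitive'[OF convex_halfspace_Im_gt open_halfspace_Im_gt hol])
    fix g assume g: "\<And>x. x \<in> ?H \<Longrightarrow> (g has_field_derivative G x) (at x within ?H)"
    have "(g has_field_derivative G z) (at z)" if "0 < Im z" for z
      using g[of z] that at_within_open[OF _ open_halfspace_Im_gt[of 0], of z] by simp
    then show thesis by (rule that)
  qed
  obtain \<phi> :: "real \<Rightarrow> complex" where \<phi>:
    "\<And>x z. x \<in> K \<Longrightarrow> z \<in> wedge x h \<Longrightarrow> cmod (F z - \<phi> x) \<le> M * cmod (z - of_real x)"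
    "\<And>x y. x \<in> K \<Longrightarrow> y \<in> K \<Longrightarrow> \<bar>x - y\<bar> < h \<Longrightarrow> cmod (\<phi> x - \<phi> y) \<le> 3 * M * \<bar>x - y\<bar>"
  proof (rule primitive_boundary_values[OF F bound \<open>0 < h\<close>])
    fix \<psi> :: "real \<Rightarrow> complex"
    assume 1: "\<And>x z. x \<in> K \<Longrightarrow> z \<in> wedge x h \<Longrightarrow> cmod (F z - \<psi> x) \<le> M * cmod (z - of_real x)"
      and 2: "\<And>x y. x \<in> K \<Longrightarrow> y \<in> K \<Longrightarrow> \<bar>x - y\<bar> < h \<Longrightarrow> cmod (\<psi> x - \<psi> y) \<le> 3 * M * \<bar>x - y\<bar>"
    show thesis using that[of \<psi>, OF 1 2] .
  qed
  \<comment> \<open>Pieces of length \<open>h/2\<close>, on which the Lipschitz estimate for \<open>\<phi>\<close> at distances below \<open>h\<close> is unrestricted.\<close>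
  define K' where "K' j = K \<inter> {real_of_int j * (h/2)..(real_of_int j + 1) * (h/2)}" for j
  have piece: "AE x in lborel. x \<in> K' j \<longrightarrow> (\<exists>c. \<forall>\<eta>>0. (G \<longlongrightarrow> c) (at (of_real x) within stolz \<eta> x))" for j
  proof -
    have near: "\<bar>x - y\<bar> < h" if "x \<in> K' j" "y \<in> K' j" for x y
      using that \<open>0 < h\<close> unfolding K'_def by (auto simp: algebra_simps abs_less_iff) 
    have lip: "(\<bar>3 * M\<bar>)-lipschitz_on (K' j) (\<lambda>x. Re (\<phi> x))" "(\<bar>3 * M\<bar>)-lipschitz_on (K' j) (\<lambda>x. Im (\<phi> x))"
    proof -
      have *: "cmod (\<phi> x - \<phi> y) \<le> \<bar>3 * M\<bar> * dist x y" if "x \<in> K' j" "y \<in> K' j" for x y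
      proof -
        have "cmod (\<phi> x - \<phi> y) \<le> 3 * M * \<bar>x - y\<bar>" using \<phi>(2) near[OF that] that by (auto simp: K'_def)
        also have "\<dots> \<le> \<bar>3 * M\<bar> * \<bar>x - y\<bar>" by (intro mult_right_mono) auto
        finally show ?thesis by (simp add: dist_real_def)
      qed
      show "(\<bar>3 * M\<bar>)-lipschitz_on (K' j) (\<lambda>x. Re (\<phi> x))"
        by (rule lipschitz_onI) (auto simp: dist_real_def intro: order_trans[OF _ *[unfolded dist_real_def]] order_trans[OF abs_Re_le_cmod[of "\<phi> _ - \<phi> _", simplified]])
      show "(\<bar>3 * M\<bar>)-lipschitz_on (K' j) (\<lambda>x. Im (\<phi> x))"
        by (rule lipschitz_onI) (auto simp: dist_real_def intro: order_trans[OF _ *[unfolded dist_real_def]] order_trans[OF abs_Im_le_cmod[of "\<phi> _ - \<phi> _", simplified]])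
    qed
    obtain f where f: "(\<bar>3 * M\<bar>)-lipschitz_on UNIV f" "\<And>x. x \<in> K' j \<Longrightarrow> f x = Re (\<phi> x)"
      using lipschitz_extension_real[OF lip(1)] by blast
    obtain g where g: "(\<bar>3 * M\<bar>)-lipschitz_on UNIV g" "\<And>x. x \<in> K' j \<Longrightarrow> g x = Im (\<phi> x)"
      using lipschitz_extension_real[OF lip(2)] by blast
    have d: "1-lipschitz_on UNIV (\<lambda>s::real. infdist s (K' j))"
      by (rule lipschitz_onI) (auto simp: dist_real_def intro: order_trans[OF infdist_triangle_abs])
    show ?thesis
      using lipschitz_differentiable_ae[OF f(1)] lipschitz_differentiable_ae[OF g(1)] lipschitz_differentiable_ae[OF d]
    proof eventually_elim
      case (elim x)
      show ?case
      proof
        assume x: "x \<in> K' j"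
        obtain a b D where ab: "(f has_real_derivative a) (at x)" "(g has_real_derivative b) (at x)"
          and D: "((\<lambda>s. infdist s (K' j)) has_real_derivative D) (at x)"
          using elim by blast
        have D0: "D = 0" using infdist_real_derivative_0[OF D x] .
        show "\<exists>c. \<forall>\<eta>>0. (G \<longlongrightarrow> c) (at (of_real x) within stolz \<eta> x)"
        proof (intro exI allI impI)
          fix \<eta> :: real assume "0 < \<eta>"
          show "(G \<longlongrightarrow> Complex a b) (at (of_real x) within stolz \<eta> x)"
          proof (rule nontangential_limit_at_boundary_derivative[OF F, where K = "K' j" and h = h and M = M and \<phi> = \<phi>])
            show "cmod (F z - \<phi> y) \<le> M * cmod (z - of_real y)" if "y \<in> K' j" "z \<in> wedge y h" for y z
              using \<phi>(1) that by (auto simp: K'_def)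
            show "\<exists>d>0. \<forall>y\<in>K' j. \<bar>y - x\<bar> < d \<longrightarrow> cmod (\<phi> y - \<phi> x - Complex a b * of_real (y - x)) \<le> e * \<bar>y - x\<bar>"
              if "0 < e" for e
            proof -
              obtain d1 where d1: "d1 > 0" "\<And>y. \<bar>y - x\<bar> < d1 \<Longrightarrow> \<bar>f y - f x - a * (y - x)\<bar> \<le> e/2 * \<bar>y - x\<bar>"
                using real_derivative_error[OF ab(1), of "e/2"] \<open>0 < e\<close> by auto
              obtain d2 where d2: "d2 > 0" "\<And>y. \<bar>y - x\<bar> < d2 \<Longrightarrow> \<bar>g y - g x - b * (y - x)\<bar> \<le> e/2 * \<bar>y - x\<bar>"
                using real_derivative_error[OF ab(2), of "e/2"] \<open>0 < e\<close> by auto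
              have "cmod (\<phi> y - \<phi> x - Complex a b * of_real (y - x)) \<le> e * \<bar>y - x\<bar>"
                if y: "y \<in> K' j" "\<bar>y - x\<bar> < min d1 d2" for y
              proof -
                have "cmod (\<phi> y - \<phi> x - Complex a b * of_real (y - x))
                  \<le> \<bar>f y - f x - a * (y - x)\<bar> + \<bar>g y - g x - b * (y - x)\<bar>"
                  using cmod_le[of "\<phi> y - \<phi> x - Complex a b * of_real (y - x)"] f(2) g(2) x y by simp
                then show ?thesis using d1(2)[of y] d2(2)[of y] y by linarith
              qed
              then show ?thesis using d1(1) d2(1) by (intro exI[of _ "min d1 d2"]) auto
            qed
            show "\<exists>d>0. \<forall>s. \<bar>s - x\<bar> < d \<longrightarrow> infdist s (K' j) \<le> e * \<bar>s - x\<bar>" if "0 < e" for e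
              using real_derivative_error[OF D \<open>0 < e\<close>] x by (simp add: D0 infdist_nonneg)
          qed (use x \<open>0 < h\<close> \<open>0 < \<eta>\<close> in auto)
        qed
      qed
    qed
  qed
  have "AE x in lborel. \<forall>j::int. x \<in> K' j \<longrightarrow> (\<exists>c. \<forall>\<eta>>0. (G \<longlongrightarrow> c) (at (of_real x) within stolz \<eta> x))"
    unfolding AE_all_countable using piece by blast
  then show ?thesis
  proof eventually_elim
    case (elim x)
    show ?case
    proof
      assume "x \<in> K"
      define j where "j = \<lfloor>x / (h/2)\<rfloor>"
      have "real_of_int j \<le> x / (h/2)" "x / (h/2) \<le> real_of_int j + 1"
        unfolding j_def by linarith+
      then have "x \<in> K' j" using \<open>x \<in> K\<close> \<open>0 < h\<close> by (simp add: K'_def field_simps)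
      then show "\<exists>c. \<forall>\<eta>>0. (G \<longlongrightarrow> c) (at (of_real x) within stolz \<eta> x)" using elim by blast
    qed
  qed
qed

section \<open>A local uniqueness theorem\<close>

definition cauchy_transform :: "real set \<Rightarrow> complex \<Rightarrow> complex" where
  "cauchy_transform A z = (LINT t|lborel. indicator A t *\<^sub>R (1 / (of_real t - z)))"

lemma norm_real_minus_ge_Im: "Im z \<le> cmod (of_real t - z)"
  using abs_Im_le_cmod[of "of_real t - z"] by simp

lemma integrable_cauchy_kernel:
  assumes [measurable]: "A \<in> sets borel" and "emeasure lborel A < \<infinity>" "0 < Im z"
  shows "integrable lborel (\<lambda>t. indicator A t *\<^sub>R (1 / (of_real t - z) ^ n))"
proof (rule integrableI_bounded_set_indicator)
  show "AE t in lborel. t \<in> A \<longrightarrow> cmod (1 / (of_real t - z) ^ n) \<le> 1 / Im z ^ n"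
    using norm_real_minus_ge_Im[of z] \<open>0 < Im z\<close>
    by (intro AE_I2 impI) (simp add: norm_divide norm_power frac_le power_mono)
qed (use assms in auto)

text \<open>
  The remainder in the expansion of the kernel to first order, which yields the derivative of the
  Cauchy transform with a quadratic error.
\<close>

lemma cauchy_kernel_taylor:
  fixes a h :: complex
  assumes "a \<noteq> 0" "a \<noteq> h"
  shows "1 / (a - h) - 1 / a - h * (1 / a\<^sup>2) = h\<^sup>2 / ((a - h) * a\<^sup>2)"
  using assms by (simp add: field_simps power2_eq_square)

lemma holomorphic_cauchy_transform:
  assumes A[measurable]: "A \<in> sets borel" and fin: "emeasure lborel A < \<infinity>"
  shows "cauchy_transform A holomorphic_on {z. 0 < Im z}"
proof -
  have "(cauchy_transform A has_field_derivative (LINT t|lborel. indicator A t *\<^sub>R (1 / (of_real t - z)\<^sup>2))) (at z)"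
    if z: "0 < Im z" for z
  proof -
    let ?D = "LINT t|lborel. indicator A t *\<^sub>R (1 / (of_real t - z)\<^sup>2)"
    define B where "B = 2 / (Im z) ^ 3"
    have B: "0 < B" using z by (simp add: B_def)
    have est: "cmod (cauchy_transform A w - cauchy_transform A z - (w - z) * ?D) \<le> (cmod (w - z))\<^sup>2 * B * measure lborel A"
      if w: "cmod (w - z) < Im z / 2" for w
    proof -
      have Imw: "Im z / 2 < Im w"
        using abs_Im_le_cmod[of "w - z"] w by (simp add: abs_le_iff)
      then have Imw0: "0 < Im w" using z by simp
      have i1: "integrable lborel (\<lambda>t. indicator A t *\<^sub>R (1 / (of_real t - w)))"
        and i2: "integrable lborel (\<lambda>t. indicator A t *\<^sub>R (1 / (of_real t - z)))"
        using integrable_cauchy_kernel[OF A fin Imw0, of 1] integrable_cauchy_kernel[OF A fin z, of 1] by simp_all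
      have i3: "integrable lborel (\<lambda>t. (w - z) * (indicator A t *\<^sub>R (1 / (of_real t - z)\<^sup>2)))"
        by (rule integrable_mult_right[OF integrable_cauchy_kernel[OF A fin z, of 2]])
      have "cauchy_transform A w - cauchy_transform A z - (w - z) * ?D
        = (LINT t|lborel. indicator A t *\<^sub>R (1 / (of_real t - w)) - indicator A t *\<^sub>R (1 / (of_real t - z))
             - (w - z) * (indicator A t *\<^sub>R (1 / (of_real t - z)\<^sup>2)))"
        unfolding cauchy_transform_def integral_mult_right_zero[symmetric]
        by (simp only: Bochner_Integration.integral_diff[OF Bochner_Integration.integrable_diff[OF i1 i2] i3]
            Bochner_Integration.integral_diff[OF i1 i2])
      also have "cmod \<dots> \<le> (LINT t|lborel. indicator A t * ((cmod (w - z))\<^sup>2 * B))"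
      proof (rule Bochner_Integration.integral_norm_bound_integral)
        show "integrable lborel (\<lambda>t. indicator A t * ((cmod (w - z))\<^sup>2 * B))"
          using A fin by auto
        show "integrable lborel (\<lambda>t. indicator A t *\<^sub>R (1 / (of_real t - w)) - indicator A t *\<^sub>R (1 / (of_real t - z))
             - (w - z) * (indicator A t *\<^sub>R (1 / (of_real t - z)\<^sup>2)))"
          using i1 i2 i3 by (intro Bochner_Integration.integrable_diff)
        fix t :: real
        have n1: "Im z \<le> cmod (of_real t - z)" and n2: "Im z / 2 \<le> cmod (of_real t - w)"
          using norm_real_minus_ge_Im[of z t] norm_real_minus_ge_Im[of w t] Imw by auto
        have ne: "of_real t - z \<noteq> 0" "of_real t - z \<noteq> w - z"
          using n1 n2 z by auto
        have "1 / (of_real t - w) - 1 / (of_real t - z) - (w - z) * (1 / (of_real t - z)\<^sup>2)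
            = (w - z)\<^sup>2 / ((of_real t - w) * (of_real t - z)\<^sup>2)"
          using cauchy_kernel_taylor[OF ne] by simp
        then have "cmod (1 / (of_real t - w) - 1 / (of_real t - z) - (w - z) * (1 / (of_real t - z)\<^sup>2))
            = (cmod (w - z))\<^sup>2 / (cmod (of_real t - w) * (cmod (of_real t - z))\<^sup>2)"
          by (simp only: norm_divide norm_mult norm_power)
        also have "\<dots> \<le> (cmod (w - z))\<^sup>2 / (Im z / 2 * (Im z)\<^sup>2)"
          using n1 n2 z by (intro divide_left_mono mult_mono power_mono mult_pos_pos) auto
        also have "\<dots> = (cmod (w - z))\<^sup>2 * B"
          by (simp add: B_def power2_eq_square power3_eq_cube)
        finally show "cmod (indicator A t *\<^sub>R (1 / (of_real t - w)) - indicator A t *\<^sub>R (1 / (of_real t - z))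
             - (w - z) * (indicator A t *\<^sub>R (1 / (of_real t - z)\<^sup>2))) \<le> indicator A t * ((cmod (w - z))\<^sup>2 * B)"
          by (simp split: split_indicator)
      qed
      also have "\<dots> = (cmod (w - z))\<^sup>2 * B * measure lborel A"
        using A fin by simp
      finally show ?thesis .
    qed
    show ?thesis
      unfolding has_field_derivative_def has_derivative_at_alt
    proof (intro conjI allI impI)
      show "bounded_linear ((*) ?D)" by (rule bounded_linear_mult_right)
      fix e :: real assume "0 < e"
      define d where "d = min (Im z / 2) (e / (B * measure lborel A + 1))"
      have pos: "0 < B * measure lborel A + 1" using B by (simp add: add_nonneg_pos)
      have d: "0 < d" using z \<open>0 < e\<close> pos by (simp add: d_def)
      have "cmod (cauchy_transform A w - cauchy_transform A z - ?D * (w - z)) \<le> e * cmod (w - z)"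
        if w: "cmod (w - z) < d" for w
      proof -
        have "cmod (w - z) * (B * measure lborel A) \<le> cmod (w - z) * (B * measure lborel A + 1)"
          by (intro mult_left_mono) auto
        also have "\<dots> \<le> e / (B * measure lborel A + 1) * (B * measure lborel A + 1)"
          using w pos by (intro mult_right_mono) (auto simp: d_def)
        also have "\<dots> = e" using pos by simp
        finally have "cmod (w - z) * (cmod (w - z) * (B * measure lborel A)) \<le> cmod (w - z) * e"
          by (rule mult_left_mono) simp
        then show ?thesis
          using est[of w] w by (simp add: d_def power2_eq_square mult_ac)
      qed
      then show "\<exists>d>0. \<forall>w. cmod (w - z) < d \<longrightarrow>
          cmod (cauchy_transform A w - cauchy_transform A z - ?D * (w - z)) \<le> e * cmod (w - z)"
        using d by blast
    qed
  qed
  then show ?thesis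
    by (auto simp: holomorphic_on_def field_differentiable_def intro: has_field_derivative_at_within)
qed

lemma Im_cauchy_kernel: "Im (1 / (of_real t - z)) = Im z / ((t - Re z)\<^sup>2 + (Im z)\<^sup>2)"
  by (simp add: Im_divide)

lemma Im_cauchy_transform:
  assumes A: "A \<in> sets borel" and fin: "emeasure lborel A < \<infinity>" and z: "0 < Im z"
  shows "integrable lborel (\<lambda>t. indicator A t * (Im z / ((t - Re z)\<^sup>2 + (Im z)\<^sup>2)))"
    and "Im (cauchy_transform A z) = (LINT t|lborel. indicator A t * (Im z / ((t - Re z)\<^sup>2 + (Im z)\<^sup>2)))"
proof -
  have i: "integrable lborel (\<lambda>t. indicator A t *\<^sub>R (1 / (of_real t - z)))"
    using integrable_cauchy_kernel[OF A fin z, of 1] by simp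
  have eq: "Im (indicator A t *\<^sub>R (1 / (of_real t - z))) = indicator A t * (Im z / ((t - Re z)\<^sup>2 + (Im z)\<^sup>2))" for t
    by (simp only: scaleR_complex.sel(2) Im_cauchy_kernel)
  show "integrable lborel (\<lambda>t. indicator A t * (Im z / ((t - Re z)\<^sup>2 + (Im z)\<^sup>2)))"
    using integrable_Im[OF i] unfolding eq .
  show "Im (cauchy_transform A z) = (LINT t|lborel. indicator A t * (Im z / ((t - Re z)\<^sup>2 + (Im z)\<^sup>2)))"
    unfolding cauchy_transform_def using integral_Im[OF i] unfolding eq by simp
qed

text \<open>
  The kernel \<open>y / ((t - x)\<^sup>2 + y\<^sup>2)\<close>, up to the factor \<open>pi\<close> the Poisson kernel, lies between 0 and
  \<open>1 / y\<close>, and it is at least \<open>1 / (2 * y)\<close> where \<open>\<bar>t - x\<bar> \<le> y\<close>.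
\<close>

lemma Im_cauchy_transform_bounds:
  assumes A: "A \<in> sets borel" and fin: "emeasure lborel A < \<infinity>" and z: "0 < Im z"
  shows "0 \<le> Im (cauchy_transform A z)"
    and "Im (cauchy_transform A z) \<le> measure lborel A / Im z"
    and "\<And>B. B \<in> sets borel \<Longrightarrow> B \<subseteq> A \<Longrightarrow> (\<And>t. t \<in> B \<Longrightarrow> \<bar>t - Re z\<bar> \<le> Im z) \<Longrightarrow>
        measure lborel B / (2 * Im z) \<le> Im (cauchy_transform A z)"
proof -
  note i = Im_cauchy_transform[OF A fin z]
  have pos: "0 < (t - Re z)\<^sup>2 + (Im z)\<^sup>2" for t
    using z by (simp add: add_nonneg_pos)
  show "0 \<le> Im (cauchy_transform A z)"
    unfolding i(2) using z by (intro integral_nonneg_AE AE_I2) (auto intro!: mult_nonneg_nonneg divide_nonneg_nonneg)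
  have "Im (cauchy_transform A z) \<le> (LINT t|lborel. indicator A t * (1 / Im z))"
    unfolding i(2)
  proof (rule integral_mono[OF i(1)])
    show "integrable lborel (\<lambda>t. indicator A t * (1 / Im z))" using A fin by auto
    show "indicator A t * (Im z / ((t - Re z)\<^sup>2 + (Im z)\<^sup>2)) \<le> indicator A t * (1 / Im z)" for t
    proof (intro mult_left_mono)
      have "Im z / ((t - Re z)\<^sup>2 + (Im z)\<^sup>2) \<le> Im z / (Im z)\<^sup>2"
        using z pos by (intro divide_left_mono) auto
      then show "Im z / ((t - Re z)\<^sup>2 + (Im z)\<^sup>2) \<le> 1 / Im z" using z by (simp add: power2_eq_square)
    qed auto
  qed
  also have "\<dots> = measure lborel A / Im z" using A fin by simp
  finally show "Im (cauchy_transform A z) \<le> measure lborel A / Im z" .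
  fix B assume B: "B \<in> sets borel" "B \<subseteq> A" and near: "\<And>t. t \<in> B \<Longrightarrow> \<bar>t - Re z\<bar> \<le> Im z"
  have finB: "emeasure lborel B < \<infinity>"
    using B A fin emeasure_mono[of B A lborel] by (simp add: order_le_less_trans)
  have "measure lborel B / (2 * Im z) = (LINT t|lborel. indicator B t * (1 / (2 * Im z)))"
    using B finB by simp
  also have "\<dots> \<le> Im (cauchy_transform A z)"
    unfolding i(2)
  proof (rule integral_mono[OF _ i(1)])
    show "integrable lborel (\<lambda>t. indicator B t * (1 / (2 * Im z)))" using B finB by auto
    fix t
    show "indicator B t * (1 / (2 * Im z)) \<le> indicator A t * (Im z / ((t - Re z)\<^sup>2 + (Im z)\<^sup>2))"
    proof (cases "t \<in> B")
      case True
      have "(t - Re z)\<^sup>2 \<le> (Im z)\<^sup>2" using near[OF True] z by (simp add: abs_le_square_iff[symmetric])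
      then have "Im z / (2 * (Im z)\<^sup>2) \<le> Im z / ((t - Re z)\<^sup>2 + (Im z)\<^sup>2)"
        using z pos[of t] by (intro divide_left_mono mult_pos_pos) auto
      then have "1 / (2 * Im z) \<le> Im z / ((t - Re z)\<^sup>2 + (Im z)\<^sup>2)"
        using z by (simp add: power2_eq_square)
      then show ?thesis using True B(2) by auto
    next
      case False
      then show ?thesis using z by (auto intro!: mult_nonneg_nonneg divide_nonneg_nonneg)
    qed
  qed
  finally show "measure lborel B / (2 * Im z) \<le> Im (cauchy_transform A z)" .
qed

text \<open>
  If \<open>K\<close> fills most of an interval, then a function that is bounded by \<open>M\<close> on the sawtooth region over
  \<open>K\<close> and by \<open>exp (- m)\<close> near \<open>K\<close> is small at a fixed interior point. This is the maximum principle for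
  \<open>G * exp (m * (b + 2 * \<i> * W))\<close>, where \<open>b\<close> is the box potential and \<open>W\<close> the Cauchy transform of the
  gaps of \<open>K\<close>. The exponent has real part \<open>m * (Re b - 2 * Im W)\<close>, which is at most \<open>m\<close> at the bottom, where
  \<open>G\<close> is small, at most 0 at the top and the lateral sides because of \<open>b\<close>, and at most 0 on the teeth because
  \<open>Im W\<close> is at least 1/2 there; at the interior point it is at least \<open>m / 4\<close>.
\<close>

lemma sawtooth_bound:
  fixes G :: "complex \<Rightarrow> complex" and K :: "real set"
  assumes hol: "G holomorphic_on {z. 0 < Im z}" and K[measurable]: "K \<in> sets borel"
    and bound: "\<And>x z. x \<in> K \<Longrightarrow> z \<in> wedge x h \<Longrightarrow> cmod (G z) \<le> M"
    and small: "\<And>x z. x \<in> K \<Longrightarrow> z \<in> wedge x \<delta> \<Longrightarrow> cmod (G z) \<le> exp (- m)"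
    and "0 < \<delta>" "1 \<le> M" "0 \<le> m" "0 < T" "T < h"
    and gap: "emeasure lborel (cball p T - K) < ennreal (T / 256)"
  shows "cmod (G (Complex p (T/16))) \<le> M * exp (- m / 4)"
proof -
  define A where "A = cball p T - K"
  have A[measurable]: "A \<in> sets borel" by (simp add: A_def)
  have fin: "emeasure lborel A < \<infinity>" using gap by (simp add: A_def order_less_trans)
  have mA: "measure lborel A < T / 256"
    using gap fin \<open>0 < T\<close> by (simp add: A_def emeasure_eq_ennreal_measure ennreal_less_iff)
  have interval: "b - a \<le> measure lborel A" if "{a<..<b} \<subseteq> A" "a \<le> b" for a b
  proof -
    have "measure lborel {a<..<b} \<le> measure lborel A"
      using that fin by (intro measure_mono_fmeasurable) (auto simp: fmeasurable_def)
    then show ?thesis using that by simp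
  qed
  have near_p: "infdist p K < T / 16" and "K \<noteq> {}"
  proof -
    have "\<exists>k\<in>K. \<bar>k - p\<bar> < T / 32"
    proof (rule ccontr)
      assume far: "\<not> ?thesis"
      have "{p - T/32<..<p + T/32} \<subseteq> A"
      proof
        fix t assume "t \<in> {p - T/32<..<p + T/32}"
        then have t: "\<bar>t - p\<bar> < T/32" unfolding greaterThanLessThan_iff by linarith
        then have "t \<notin> K" using far by blast
        moreover have "dist p t \<le> T" using t \<open>0 < T\<close> by (simp add: dist_real_def abs_minus_commute)
        ultimately show "t \<in> A" by (simp add: A_def)
      qed
      then have "(p + T/32) - (p - T/32) \<le> measure lborel A" using \<open>0 < T\<close> by (intro interval) auto
      then show False using mA \<open>0 < T\<close> by simp
    qed
    then obtain k where k: "k \<in> K" "\<bar>k - p\<bar> < T / 32" by blast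
    then have "infdist p K \<le> T / 32" by (intro infdist_le2[of k]) (simp_all add: dist_real_def abs_minus_commute)
    then show "infdist p K < T / 16" using \<open>0 < T\<close> by simp
    show "K \<noteq> {}" using k by blast
  qed
  define \<tau> where "\<tau> = min (\<delta>/2) (T/32)"
  have \<tau>: "0 < \<tau>" "\<tau> < \<delta>" "\<tau> \<le> T/32" using \<open>0 < \<delta>\<close> \<open>0 < T\<close> by (auto simp: \<tau>_def)
  \<comment> \<open>The sawtooth region over \<open>K\<close>, cut off at height \<open>\<tau>\<close> so that its closure avoids the real line.\<close>
  define U where "U = {z. \<bar>Re z - p\<bar> < T} \<inter> {z. \<tau> < Im z} \<inter> {z. Im z < T/2} \<inter> {z. infdist (Re z) K < Im z}"
  define V where "V = {z. \<bar>Re z - p\<bar> \<le> T} \<inter> {z. \<tau> \<le> Im z} \<inter> {z. Im z \<le> T/2} \<inter> {z. infdist (Re z) K \<le> Im z}"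
  have "open U" unfolding U_def
    by (intro open_Int open_Collect_less continuous_intros)
  have "closed V" unfolding V_def
    by (intro closed_Int closed_Collect_le continuous_intros)
  have "U \<subseteq> V" by (auto simp: U_def V_def)
  then have clU: "closure U \<subseteq> V" using \<open>closed V\<close> by (rule closure_minimal)
  have VH: "V \<subseteq> {z. 0 < Im z}" using \<tau> by (auto simp: V_def)
  have in_wedge: "\<exists>x\<in>K. z \<in> wedge x d" if near: "infdist (Re z) K < Im z" and low: "Im z < d" for z d
  proof -
    obtain x where "x \<in> K" "dist (Re z) x < Im z"
      by (rule infdist_less_imp_near[OF near \<open>K \<noteq> {}\<close>])
    then show ?thesis using low by (intro bexI[of _ x]) (auto simp: wedge_def dist_real_def)
  qed
  have GU: "cmod (G z) \<le> M" if "z \<in> U" for z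
    using in_wedge[of z h] that bound \<open>T < h\<close> \<open>0 < T\<close> by (auto simp: U_def)
  have contG: "continuous_on (closure U) G"
    using hol clU VH by (meson continuous_on_subset holomorphic_on_imp_continuous_on order_trans)
  have GclU: "cmod (G z) \<le> M" if "z \<in> closure U" for z
    using continuous_on_closure_norm_le[OF contG _ that] GU by blast
  define W where "W = cauchy_transform A"
  define q where "q z = (z - of_real p) / of_real T" for z :: complex
  have Req: "Re (q w) = (Re w - p) / T" and Imq: "Im (q w) = Im w / T" for w
    using \<open>0 < T\<close> by (simp_all add: q_def Re_divide_of_real Im_divide_of_real)
  \<comment> \<open>\<open>Im W\<close> is at least 1/2 on the teeth and small at the point of evaluation, because \<open>A\<close> is short.\<close>
  define g where "g z = G z * exp (of_real m * (box_potential (q z) + 2 * \<i> * W z))" for z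
  have normg: "cmod (g z) = cmod (G z) * exp (m * (Re (box_potential (q z)) - 2 * Im (W z)))" for z
    by (simp add: g_def norm_mult)
  have holg: "g holomorphic_on {z. 0 < Im z}"
    unfolding g_def q_def W_def using hol holomorphic_cauchy_transform[OF A fin] \<open>0 < T\<close>
    by (intro holomorphic_intros) auto
  \<comment> \<open>Over a tooth point at height \<open>y\<close> the set \<open>A\<close> fills one side of the interval of radius \<open>y\<close>.\<close>
  have tooth: "1/2 \<le> Im (W z)" if z: "z \<in> V" "infdist (Re z) K = Im z" for z
  proof -
    have z0: "0 < Im z" using z(1) VH by auto
    define a where "a = (if Re z \<le> p then Re z else Re z - Im z)"
    have off: "t \<notin> K" if "\<bar>t - Re z\<bar> < Im z" for t
      using infdist_le[of t K "Re z"] that z(2) by (auto simp: dist_real_def abs_minus_commute)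
    have "{a<..<a + Im z} \<subseteq> A"
    proof
      fix t assume t: "t \<in> {a<..<a + Im z}"
      then have "\<bar>t - Re z\<bar> < Im z" by (auto simp: a_def split: if_splits)
      then have "t \<notin> K" by (rule off)
      moreover have "\<bar>t - p\<bar> \<le> T"
        using t z(1) by (auto simp: a_def V_def abs_le_iff split: if_splits)
      ultimately show "t \<in> A" by (auto simp: A_def dist_real_def abs_minus_commute)
    qed
    moreover have "\<bar>t - Re z\<bar> \<le> Im z" if "t \<in> {a<..<a + Im z}" for t
      using that by (auto simp: a_def split: if_splits)
    ultimately have "measure lborel {a<..<a + Im z} / (2 * Im z) \<le> Im (cauchy_transform A z)"
      by (intro Im_cauchy_transform_bounds(3)[OF A fin z0]) auto
    then show ?thesis using z0 by (simp add: W_def)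
  qed
  define z0 where "z0 = Complex p (T/16)"
  have "cmod (g z0) \<le> M"
  proof (rule maximum_modulus_frontier[where f = g and S = U])
    show "g holomorphic_on interior U"
      using holg \<open>U \<subseteq> V\<close> VH by (meson holomorphic_on_subset interior_subset order_trans)
    show "continuous_on (closure U) g"
      using holg clU VH by (meson continuous_on_subset holomorphic_on_imp_continuous_on order_trans)
    show "bounded U"
    proof (rule bounded_subset)
      show "U \<subseteq> cbox (Complex (p - T) 0) (Complex (p + T) T)"
        using \<tau> \<open>0 < T\<close> by (auto simp: U_def in_cbox_complex_iff abs_less_iff)
    qed (rule bounded_cbox)
    show "z0 \<in> U" using near_p \<tau> \<open>0 < T\<close> by (auto simp: U_def z0_def)
    fix z assume "z \<in> frontier U"
    then have zcl: "z \<in> closure U" and znU: "z \<notin> U"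
      using \<open>open U\<close> by (auto simp: frontier_def interior_open)
    have zV: "z \<in> V" using zcl clU by blast
    have Imz: "0 < Im z" using zV VH by auto
    have q0: "0 \<le> Im (q z)" "Im (q z) \<le> 1/2"
      using zV Imz \<open>0 < T\<close> by (auto simp: Imq V_def field_simps)
    have W0: "0 \<le> Im (W z)"
      unfolding W_def by (rule Im_cauchy_transform_bounds(1)[OF A fin Imz])
    have le_M: "cmod (g z) \<le> M" if "Re (box_potential (q z)) - 2 * Im (W z) \<le> 0"
    proof -
      have "m * (Re (box_potential (q z)) - 2 * Im (W z)) \<le> 0"
        using that \<open>0 \<le> m\<close> by (simp add: mult_nonneg_nonpos)
      then have "cmod (g z) \<le> M * 1"
        unfolding normg using GclU[OF zcl] \<open>1 \<le> M\<close> by (intro mult_mono) auto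
      then show ?thesis by simp
    qed
    consider "infdist (Re z) K = Im z" | "infdist (Re z) K < Im z" "Im z = \<tau>"
      | "\<bar>Re z - p\<bar> = T \<or> Im z = T/2"
      using zV znU by (force simp: U_def V_def)
    then show "cmod (g z) \<le> M"
    proof cases
      case 1
      then show ?thesis using tooth[OF zV 1] box_potential_le_1[OF q0] by (intro le_M) linarith
    next
      case 2
      then have "cmod (G z) \<le> exp (- m)"
        using in_wedge[of z \<delta>] small \<tau> by auto
      moreover have "m * (Re (box_potential (q z)) - 2 * Im (W z)) \<le> m"
        using box_potential_le_1[OF q0] W0 \<open>0 \<le> m\<close> by (intro mult_left_le) auto
      ultimately have "cmod (g z) \<le> exp (- m) * exp m"
        unfolding normg by (intro mult_mono) auto
      then show ?thesis using \<open>1 \<le> M\<close> by (simp flip: exp_add)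
    next
      case 3
      then have "\<bar>Re (q z)\<bar> = 1 \<or> Im (q z) = 1/2"
        using \<open>0 < T\<close> by (auto simp: Req Imq abs_divide)
      then show ?thesis using box_potential_le_0[OF q0] W0 by (intro le_M) auto
    qed
  qed
  moreover have "exp (m / 4) \<le> exp (m * (Re (box_potential (q z0)) - 2 * Im (W z0)))"
  proof -
    have "1/2 \<le> Re (box_potential (q z0))"
      using \<open>0 < T\<close> by (intro box_potential_ge_half) (auto simp: Req Imq z0_def)
    moreover have "Im (W z0) \<le> 1/8"
    proof -
      have "Im (W z0) \<le> measure lborel A / (T/16)"
        using Im_cauchy_transform_bounds(2)[OF A fin, of z0] \<open>0 < T\<close> by (simp add: W_def z0_def)
      also have "\<dots> \<le> (T/256) / (T/16)"
        using mA \<open>0 < T\<close> by (intro divide_right_mono) auto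
      also have "\<dots> \<le> 1/8" using \<open>0 < T\<close> by simp
      finally show ?thesis .
    qed
    ultimately have "1/4 \<le> Re (box_potential (q z0)) - 2 * Im (W z0)" by linarith
    then have "m * (1/4) \<le> m * (Re (box_potential (q z0)) - 2 * Im (W z0))"
      using \<open>0 \<le> m\<close> by (rule mult_left_mono)
    then show ?thesis by simp
  qed
  ultimately have "cmod (G z0) * exp (m / 4) \<le> M"
    unfolding normg by (meson mult_left_mono norm_ge_zero order_trans)
  then show ?thesis by (simp add: z0_def exp_minus field_simps)
qed

text \<open>
  Wedges are open and depend on \<open>x\<close> by translation, so a violation at \<open>x\<close> persists nearby. This makes
  all exceptional sets Borel.
\<close>

lemma closed_wedge_condition: "closed {x. \<forall>z\<in>wedge x h. P z}"
proof -
  have "{x. \<forall>z\<in>wedge x h. P z} = - (\<Union>z\<in>{z. \<not> P z}. {x. z \<in> wedge x h})" by auto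
  moreover have "open {x. z \<in> wedge x h}" for z
    unfolding wedge_def mem_Collect_eq by (intro open_Collect_conj open_Collect_less continuous_intros)
  ultimately show ?thesis by (simp only:) (intro closed_Compl open_UN ballI)
qed

lemma wedge_mono: "h \<le> h' \<Longrightarrow> wedge x h \<subseteq> wedge x h'"
  by (auto simp: wedge_def)

lemma wedge_near_vertex:
  assumes "z \<in> wedge x h"
  shows "z \<in> stolz (1/2) x" "cmod (z - of_real x) < 2 * h" "z \<noteq> of_real x"
proof -
  have "cmod (z - of_real x) \<le> \<bar>Re z - x\<bar> + \<bar>Im z\<bar>" using cmod_le[of "z - of_real x"] by simp
  then show "z \<in> stolz (1/2) x" "cmod (z - of_real x) < 2 * h" "z \<noteq> of_real x"
    using assms by (auto simp: wedge_def stolz_def)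
qed

text \<open>
  Suppose \<open>G\<close> tends to 0 on a set of positive measure. For every \<open>m\<close>, the points over which
  \<open>\<bar>G\<bar> \<le> exp (- m)\<close> holds up to some height fill most of one and the same interval, so the sawtooth
  estimate gives \<open>\<bar>G\<bar> \<le> M * exp (- m / 4)\<close> at one and the same point, where \<open>G\<close> would have to vanish.
\<close>

lemma local_uniqueness:
  fixes G :: "complex \<Rightarrow> complex"
  assumes hol: "G holomorphic_on {z. 0 < Im z}"
    and nz: "\<And>z. 0 < Im z \<Longrightarrow> G z \<noteq> 0"
    and bound: "\<And>x z. x \<in> K \<Longrightarrow> z \<in> wedge x h \<Longrightarrow> cmod (G z) \<le> M"
    and "0 < h"
  shows "AE x in lborel. x \<in> K \<longrightarrow> \<not> (G \<longlongrightarrow> 0) (at (of_real x) within stolz (1/2) x)"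
proof -
  \<comment> \<open>The maximum with 1 provides the hypothesis \<open>1 \<le> M\<close> of the sawtooth estimate.\<close>
  define KM where "KM = {x. \<forall>z\<in>wedge x h. cmod (G z) \<le> max 1 M}"
  define S where "S m k = {x. \<forall>z\<in>wedge x (1 / real (Suc k)). cmod (G z) \<le> exp (- real m)}" for m k :: nat
  have KM[measurable]: "KM \<in> sets borel" unfolding KM_def using closed_wedge_condition by (rule borel_closed)
  have S[measurable]: "S m k \<in> sets borel" for m k unfolding S_def using closed_wedge_condition by (rule borel_closed)
  have S_mono: "S m k \<subseteq> S m l" if "k \<le> l" for m k l
  proof -
    have "1 / real (Suc l) \<le> 1 / real (Suc k)" using that by (intro divide_left_mono) auto
    from wedge_mono[OF this] show ?thesis unfolding S_def by blast
  qed
  define Z where "Z = KM \<inter> (\<Inter>m. \<Union>k. S m k)"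
  have Z[measurable]: "Z \<in> sets borel" by (simp add: Z_def)
  have "emeasure lborel Z = 0"
  proof (rule ccontr)
    assume "emeasure lborel Z \<noteq> 0"
    then have pos: "0 < emeasure lborel Z" by (simp add: zero_less_iff_neq_zero)
    obtain p T where T: "0 < T" "T < h" and gap: "emeasure lborel (cball p T - Z) < ennreal (1/256 * T)"
    proof (rule interval_of_high_density[OF Z pos, of "1/256" h])
      fix p T assume "0 < T" "T < h" "emeasure lborel (cball p T - Z) < ennreal (1/256 * T)"
      then show thesis by (rule that)
    qed (use \<open>0 < h\<close> in auto)
    \<comment> \<open>The point of evaluation is fixed by \<open>Z\<close> before \<open>m\<close> and \<open>k\<close>, so the bounds for all \<open>m\<close> concern one point.\<close>
    have "cmod (G (Complex p (T/16))) \<le> max 1 M * exp (- real m / 4)" for m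
    proof -
      have dec: "decseq (\<lambda>k. cball p T - (KM \<inter> S m k))"
      proof (rule decseq_SucI)
        show "cball p T - (KM \<inter> S m (Suc k)) \<subseteq> cball p T - (KM \<inter> S m k)" for k
          using S_mono[of k "Suc k" m] by auto
      qed
      have "(\<lambda>k. emeasure lborel (cball p T - (KM \<inter> S m k))) \<longlonglongrightarrow> emeasure lborel (\<Inter>k. cball p T - (KM \<inter> S m k))"
      proof (rule Lim_emeasure_decseq[OF _ dec])
        fix k
        have "emeasure lborel (cball p T - (KM \<inter> S m k)) \<le> emeasure lborel (cball p T)"
          by (intro emeasure_mono) auto
        also have "\<dots> < \<infinity>" by (simp add: cball_eq_atLeastAtMost emeasure_lborel_Icc_eq)
        finally show "emeasure lborel (cball p T - (KM \<inter> S m k)) \<noteq> \<infinity>" by simp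
      qed auto
      moreover have "emeasure lborel (\<Inter>k. cball p T - (KM \<inter> S m k)) < ennreal (T / 256)"
      proof -
        have "emeasure lborel (\<Inter>k. cball p T - (KM \<inter> S m k)) \<le> emeasure lborel (cball p T - Z)"
          by (intro emeasure_mono) (auto simp: Z_def)
        then show ?thesis using gap by simp
      qed
      ultimately have "\<forall>\<^sub>F k in sequentially. emeasure lborel (cball p T - (KM \<inter> S m k)) < ennreal (T / 256)"
        by (rule order_tendstoD(2))
      then obtain k where k: "emeasure lborel (cball p T - (KM \<inter> S m k)) < ennreal (T / 256)"
        by (meson eventually_happens' sequentially_bot)
      have KS: "KM \<inter> S m k \<in> sets borel" by simp
      show ?thesis
        by (rule sawtooth_bound[OF hol KS _ _ _ _ _ T k, where \<delta> = "1 / real (Suc k)"])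
           (auto simp: KM_def S_def)
    qed
    note le = this
    have "(\<lambda>m::nat. max 1 M * exp (- real m / 4)) \<longlonglongrightarrow> 0" by real_asymp
    then have "cmod (G (Complex p (T/16))) \<le> 0"
      by (rule LIMSEQ_le_const) (use le in blast)
    then show False using nz[of "Complex p (T/16)"] T by simp
  qed
  then have "Z \<in> null_sets lborel" by (auto simp: null_sets_def)
  moreover have "x \<in> Z" if xK: "x \<in> K" and lim: "(G \<longlongrightarrow> 0) (at (of_real x) within stolz (1/2) x)" for x
  proof -
    have "\<exists>k. x \<in> S m k" for m
    proof -
      obtain d where d: "d > 0" "\<And>z. z \<in> stolz (1/2) x \<Longrightarrow> z \<noteq> of_real x \<Longrightarrow> dist z (of_real x) < d \<Longrightarrow> dist (G z) 0 < exp (- real m)"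
        using tendstoD[OF lim, of "exp (- real m)"] unfolding eventually_at by auto
      obtain k where k: "1 / real (Suc k) < d/2" using nat_approx_posE[of "d/2"] d(1) by auto
      have "cmod (G z) \<le> exp (- real m)" if "z \<in> wedge x (1 / real (Suc k))" for z
      proof -
        note w = wedge_near_vertex[OF that]
        have "dist z (of_real x) < d" using w(2) k by (simp add: dist_norm)
        from d(2)[OF w(1) w(3) this] show ?thesis by simp
      qed
      then show ?thesis unfolding S_def by blast
    qed
    moreover have "x \<in> KM" using bound[OF xK] by (auto simp: KM_def le_max_iff_disj)
    ultimately show ?thesis by (simp add: Z_def)
  qed
  ultimately show ?thesis by (intro AE_I'[of Z]) auto
qed

section \<open>Recovering the logarithm\<close>

lemma convex_stolz:
  assumes "0 \<le> \<eta>" shows "convex (stolz \<eta> x)"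
proof (rule convexI)
  fix z w :: complex and a b :: real
  assume zw: "z \<in> stolz \<eta> x" "w \<in> stolz \<eta> x" and ab: "0 \<le> a" "0 \<le> b" "a + b = 1"
  have "a *\<^sub>R z + b *\<^sub>R w - of_real x = of_real a * (z - of_real x) + of_real b * (w - of_real x)"
  proof -
    have "of_real x = of_real a * of_real x + of_real b * (of_real x :: complex)"
      using ab(3) by (metis distrib_right mult_1 of_real_1 of_real_add)
    then show ?thesis by (simp add: scaleR_conv_of_real algebra_simps)
  qed
  also have "cmod \<dots> \<le> a * cmod (z - of_real x) + b * cmod (w - of_real x)"
    using ab by (intro order_trans[OF norm_triangle_ineq]) (simp add: norm_mult)
  finally have "\<eta> * cmod (a *\<^sub>R z + b *\<^sub>R w - of_real x) \<le> \<eta> * (a * cmod (z - of_real x) + b * cmod (w - of_real x))"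
    using assms by (rule mult_left_mono)
  also have "\<dots> = a * (\<eta> * cmod (z - of_real x)) + b * (\<eta> * cmod (w - of_real x))"
    by (simp add: algebra_simps)
  also have "\<dots> < a * Im z + b * Im w"
  proof (cases "a = 0")
    case True
    then show ?thesis using zw ab by (simp add: stolz_def)
  next
    case False
    then have "a * (\<eta> * cmod (z - of_real x)) < a * Im z"
      using zw ab by (simp add: stolz_def)
    moreover have "b * (\<eta> * cmod (w - of_real x)) \<le> b * Im w"
      using zw ab by (intro mult_left_mono) (auto simp: stolz_def)
    ultimately show ?thesis by linarith
  qed
  finally show "a *\<^sub>R z + b *\<^sub>R w \<in> stolz \<eta> x" by (simp add: stolz_def)
qed

lemma stolz_subset_halfplane:
  assumes "0 \<le> \<eta>" shows "stolz \<eta> x \<subseteq> {z. 0 < Im z}"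
proof
  fix z assume "z \<in> stolz \<eta> x"
  then have "\<eta> * cmod (z - of_real x) < Im z" by (simp add: stolz_def)
  moreover have "0 \<le> \<eta> * cmod (z - of_real x)" using assms by simp
  ultimately have "0 < Im z" by linarith
  then show "z \<in> {z. 0 < Im z}" by simp
qed

lemma stolz_mono:
  assumes "\<eta> \<le> \<eta>'" shows "stolz \<eta>' x \<subseteq> stolz \<eta> x"
proof
  fix z assume "z \<in> stolz \<eta>' x"
  moreover have "\<eta> * cmod (z - of_real x) \<le> \<eta>' * cmod (z - of_real x)"
    using assms by (intro mult_right_mono) auto
  ultimately show "z \<in> stolz \<eta> x" by (simp add: stolz_def)
qed

lemma at_within_stolz_nontrivial:
  assumes "\<eta> < 1" shows "at (of_real x) within stolz \<eta> x \<noteq> bot"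
  unfolding trivial_limit_within islimpt_approachable not_not
proof (intro allI impI)
  fix e :: real assume "0 < e"
  define z where "z = Complex x (e/2)"
  have d: "z - of_real x = \<i> * of_real (e/2)" by (simp add: z_def complex_eq_iff)
  have n: "cmod (z - of_real x) = e/2" unfolding d using \<open>0 < e\<close> by (simp add: norm_mult)
  have "\<eta> * (e/2) < 1 * (e/2)" using assms \<open>0 < e\<close> by (intro mult_strict_right_mono) auto
  then have "z \<in> stolz \<eta> x" unfolding stolz_def mem_Collect_eq n by (simp add: z_def)
  moreover have "z \<noteq> of_real x" "dist z (of_real x) < e"
    using n \<open>0 < e\<close> by (auto simp: dist_norm)
  ultimately show "\<exists>w\<in>stolz \<eta> x. w \<noteq> of_real x \<and> dist w (of_real x) < e" by blast
qed

text \<open>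
  Near the vertex \<open>exp f / c\<close> stays in the disk of radius 1 around 1, and \<open>f\<close> differs from the
  principal logarithm of this quotient by a constant, because Stolz regions are connected.
\<close>

lemma exp_limit_imp_limit_stolz:
  fixes f :: "complex \<Rightarrow> complex"
  assumes cont: "continuous_on {z. 0 < Im z} f" and "0 < \<eta>" "c \<noteq> 0"
    and lim: "((\<lambda>z. exp (f z)) \<longlongrightarrow> c) (at (of_real x) within stolz \<eta> x)"
  shows "\<exists>l. (f \<longlongrightarrow> l) (at (of_real x) within stolz \<eta> x)"
proof -
  have lim1: "((\<lambda>z. exp (f z) / c) \<longlongrightarrow> 1) (at (of_real x) within stolz \<eta> x)"
    using tendsto_divide[OF lim tendsto_const[of c]] \<open>c \<noteq> 0\<close> by simp
  obtain r where r: "r > 0" "\<And>z. z \<in> stolz \<eta> x \<Longrightarrow> z \<noteq> of_real x \<Longrightarrow> dist z (of_real x) < r \<Longrightarrow> dist (exp (f z) / c) 1 < 1"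
    using tendstoD[OF lim1, of 1] unfolding eventually_at by auto
  define S where "S = stolz \<eta> x \<inter> ball (of_real x) r"
  have SH: "S \<subseteq> {z. 0 < Im z}" using stolz_subset_halfplane[of \<eta> x] \<open>0 < \<eta>\<close> by (auto simp: S_def)
  have near1: "exp (f z) / c \<notin> \<real>\<^sub>\<le>\<^sub>0" if z: "z \<in> S" for z
  proof -
    have "z \<noteq> of_real x" using SH z by auto
    then have "cmod (exp (f z) / c - 1) < 1"
      using r(2)[of z] z by (auto simp: S_def dist_norm norm_minus_commute)
    then have "0 < Re (exp (f z) / c)"
      using abs_Re_le_cmod[of "exp (f z) / c - 1"] by (simp add: abs_le_iff)
    then show ?thesis by (auto simp: complex_nonpos_Reals_iff)
  qed
  \<comment> \<open>\<open>L\<close> takes values among the logarithms of \<open>c\<close>, which are \<open>2 * pi\<close> apart.\<close>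
  define L where "L z = f z - Ln (exp (f z) / c)" for z
  have contf: "continuous_on S f" using cont SH by (rule continuous_on_subset)
  have "L constant_on S"
  proof (rule continuous_discrete_range_constant)
    show "connected S" unfolding S_def using \<open>0 < \<eta>\<close>
      by (intro convex_connected convex_Int convex_stolz convex_ball) auto
    show "continuous_on S L" unfolding L_def
      using contf near1 \<open>c \<noteq> 0\<close> by (intro continuous_intros) auto
    fix z assume "z \<in> S"
    have expL: "exp (L w) = c" for w
      using \<open>c \<noteq> 0\<close> by (simp add: L_def exp_diff)
    have "1 \<le> cmod (L w - L z)" if "L w \<noteq> L z" for w
    proof (rule ccontr)
      assume "\<not> ?thesis"
      then have "\<bar>Im (L w) - Im (L z)\<bar> < 2 * pi"
        using abs_Im_le_cmod[of "L w - L z"] pi_gt3 by simp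
      then show False using exp_complex_eqI[of "L w" "L z"] expL that by simp
    qed
    then show "\<exists>e>0. \<forall>y. y \<in> S \<and> L y \<noteq> L z \<longrightarrow> e \<le> cmod (L y - L z)"
      by (intro exI[of _ 1]) auto
  qed
  then obtain k where k: "\<And>z. z \<in> S \<Longrightarrow> L z = k" unfolding constant_on_def by blast
  have "((\<lambda>z. k + Ln (exp (f z) / c)) \<longlongrightarrow> k + Ln 1) (at (of_real x) within stolz \<eta> x)"
    using lim1 by (intro tendsto_intros) (auto simp: complex_nonpos_Reals_iff)
  moreover have "\<forall>\<^sub>F z in at (of_real x) within stolz \<eta> x. k + Ln (exp (f z) / c) = f z"
    unfolding eventually_at
  proof (intro exI[of _ r] conjI ballI impI)
    fix z assume "z \<in> stolz \<eta> x" "z \<noteq> of_real x \<and> dist z (of_real x) < r"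
    then have "z \<in> S" by (auto simp: S_def dist_commute)
    then show "k + Ln (exp (f z) / c) = f z" using k[of z] by (simp add: L_def algebra_simps)
  qed (use r in simp)
  ultimately show ?thesis using Lim_transform_eventually by blast
qed

text \<open>
  The limits for different apertures agree, because smaller Stolz regions lie in larger ones.
\<close>

lemma exp_limit_imp_limit_all_stolz:
  fixes f :: "complex \<Rightarrow> complex"
  assumes cont: "continuous_on {z. 0 < Im z} f" and "c \<noteq> 0"
    and lim: "\<And>\<eta>. 0 < \<eta> \<Longrightarrow> ((\<lambda>z. exp (f z)) \<longlongrightarrow> c) (at (of_real x) within stolz \<eta> x)"
  shows "\<exists>l. \<forall>\<eta>>0. (f \<longlongrightarrow> l) (at (of_real x) within stolz \<eta> x)"
proof -
  have ex: "\<exists>l. (f \<longlongrightarrow> l) (at (of_real x) within stolz \<eta> x)" if "0 < \<eta>" for \<eta>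
    using exp_limit_imp_limit_stolz[OF cont that \<open>c \<noteq> 0\<close> lim[OF that]] .
  obtain l where l: "(f \<longlongrightarrow> l) (at (of_real x) within stolz (1/2) x)" using ex[of "1/2"] by auto
  have "(f \<longlongrightarrow> l) (at (of_real x) within stolz \<eta> x)" if "0 < \<eta>" for \<eta>
  proof -
    define \<mu> where "\<mu> = min \<eta> (1/2)"
    have "0 < \<mu>" using \<open>0 < \<eta>\<close> by (simp add: \<mu>_def)
    then obtain l' where l': "(f \<longlongrightarrow> l') (at (of_real x) within stolz \<mu> x)"
      using ex by blast
    have "(f \<longlongrightarrow> l') (at (of_real x) within stolz (1/2) x)"
      by (rule tendsto_within_subset[OF l' stolz_mono]) (simp add: \<mu>_def)
    then have "l' = l" using tendsto_unique[OF at_within_stolz_nontrivial] l by force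
    then show ?thesis
      using tendsto_within_subset[OF l' stolz_mono, of \<eta>] by (simp add: \<mu>_def)
  qed
  then show ?thesis by blast
qed

text \<open>
  An upper bound for \<open>Re f\<close> is a bound for \<open>exp f\<close>. By the local Fatou theorem \<open>exp f\<close> has limits, by the
  local uniqueness theorem they are almost never 0, and then the logarithm can be undone.
\<close>

theorem local_privalov:
  fixes f :: "complex \<Rightarrow> complex"
  assumes hol: "f holomorphic_on {z. 0 < Im z}"
  shows "AE x in lborel. (\<exists>h>0. \<exists>B. \<forall>z\<in>wedge x h. Re (f z) \<le> B) \<longrightarrow>
           (\<exists>l. \<forall>\<eta>>0. (f \<longlongrightarrow> l) (at (of_real x) within stolz \<eta> x))"
proof -
  define K where "K n = {x. \<forall>z\<in>wedge x (1 / real (Suc n)). Re (f z) \<le> real n}" for n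
  have holG: "(\<lambda>z. exp (f z)) holomorphic_on {z. 0 < Im z}" using hol by (intro holomorphic_intros)
  have bound: "cmod (exp (f z)) \<le> exp (real n)" if "x \<in> K n" "z \<in> wedge x (1 / real (Suc n))" for x z n
    using that by (auto simp: K_def)
  have "AE x in lborel. x \<in> K n \<longrightarrow> (\<exists>l. \<forall>\<eta>>0. (f \<longlongrightarrow> l) (at (of_real x) within stolz \<eta> x))" for n
  proof -
    have h: "0 < 1 / real (Suc n)" by simp
    have fatou: "AE x in lborel. x \<in> K n \<longrightarrow> (\<exists>c. \<forall>\<eta>>0. ((\<lambda>z. exp (f z)) \<longlongrightarrow> c) (at (of_real x) within stolz \<eta> x))"
      by (rule local_fatou[OF holG bound h])
    have uniq: "AE x in lborel. x \<in> K n \<longrightarrow> \<not> ((\<lambda>z. exp (f z)) \<longlongrightarrow> 0) (at (of_real x) within stolz (1/2) x)"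
      by (rule local_uniqueness[OF holG exp_not_eq_zero bound h])
    show ?thesis
      using fatou uniq
    proof eventually_elim
      case (elim x)
      show ?case
      proof
        assume "x \<in> K n"
        then obtain c where c: "\<And>\<eta>. 0 < \<eta> \<Longrightarrow> ((\<lambda>z. exp (f z)) \<longlongrightarrow> c) (at (of_real x) within stolz \<eta> x)"
          using elim(1) by blast
        have "c \<noteq> 0" using c[of "1/2"] elim(2) \<open>x \<in> K n\<close> by auto
        with exp_limit_imp_limit_all_stolz[OF holomorphic_on_imp_continuous_on[OF hol]] c
        show "\<exists>l. \<forall>\<eta>>0. (f \<longlongrightarrow> l) (at (of_real x) within stolz \<eta> x)" by blast
      qed
    qed
  qed
  then have "AE x in lborel. \<forall>n. x \<in> K n \<longrightarrow> (\<exists>l. \<forall>\<eta>>0. (f \<longlongrightarrow> l) (at (of_real x) within stolz \<eta> x))"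
    unfolding AE_all_countable by blast
  then show ?thesis
  proof eventually_elim
    case (elim x)
    show ?case
    proof
      assume "\<exists>h>0. \<exists>B. \<forall>z\<in>wedge x h. Re (f z) \<le> B"
      then obtain h B where hB: "0 < h" "\<forall>z\<in>wedge x h. Re (f z) \<le> B" by blast
      obtain n1 where n1: "1 / real (Suc n1) < h" using nat_approx_posE[OF hB(1)] by blast
      obtain n2 where n2: "B \<le> real n2" using real_arch_simple by blast
      define n where "n = max n1 n2"
      have "1 / real (Suc n) \<le> 1 / real (Suc n1)" by (intro divide_left_mono) (auto simp: n_def)
      then have "wedge x (1 / real (Suc n)) \<subseteq> wedge x h" using n1 by (intro wedge_mono) linarith
      moreover have "B \<le> real n" using n2 by (simp add: n_def)
      ultimately have "x \<in> K n" using hB(2) unfolding K_def by force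
      then show "\<exists>l. \<forall>\<eta>>0. (f \<longlongrightarrow> l) (at (of_real x) within stolz \<eta> x)" using elim by blast
    qed
  qed
qed

section \<open>From the half plane to the disk\<close>

lemma Re_eq_cmod_cos_Arg: "Re z = cmod z * cos (Arg z)"
  using rcis_cmod_Arg[of z] by (metis Re_rcis)

lemma cos_lt_imp_Arg_lt:
  assumes "0 \<le> \<alpha>" "\<alpha> \<le> pi" "cos \<alpha> * cmod q < Re q"
  shows "\<bar>Arg q\<bar> < \<alpha>"
proof (rule ccontr)
  assume "\<not> ?thesis"
  then have "cos \<bar>Arg q\<bar> \<le> cos \<alpha>"
    using assms mpi_less_Arg[of q] Arg_le_pi[of q] by (intro cos_monotone_0_pi_le) auto
  then have "cmod q * cos (Arg q) \<le> cmod q * cos \<alpha>"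
    by (intro mult_left_mono) auto
  then show False using assms(3) Re_eq_cmod_cos_Arg[of q] by (simp add: mult.commute)
qed

lemma Arg_lt_imp_Re_ge:
  assumes "\<alpha> \<le> pi" "\<bar>Arg q\<bar> < \<alpha>"
  shows "cos \<alpha> * cmod q \<le> Re q"
proof -
  have "cos \<alpha> \<le> cos \<bar>Arg q\<bar>"
    using assms by (intro cos_monotone_0_pi_le) auto
  then have "cmod q * cos \<alpha> \<le> cmod q * cos (Arg q)"
    by (intro mult_left_mono) auto
  then show ?thesis using Re_eq_cmod_cos_Arg[of q] by (simp add: mult.commute)
qed

lemma angle_at_subset_ball:
  assumes "cmod \<zeta> = 1" "0 < \<alpha>" "\<alpha> < pi/2" "r \<le> cos \<alpha>"
  shows "angle_at \<zeta> \<alpha> r \<subseteq> ball 0 1"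
proof
  fix z assume z: "z \<in> angle_at \<zeta> \<alpha> r"
  define q where "q = (\<zeta> - z) / \<zeta>"
  have "\<zeta> \<noteq> 0" using assms(1) by auto
  have zq: "z = \<zeta> * (1 - q)" using \<open>\<zeta> \<noteq> 0\<close> by (simp add: q_def field_simps)
  have nq: "cmod q = dist z \<zeta>" using assms(1) by (simp add: q_def norm_divide dist_norm norm_minus_commute)
  have q: "\<bar>Arg q\<bar> < \<alpha>" "0 < cmod q" "cmod q < cos \<alpha>"
    using z assms(4) unfolding angle_at_def nq by (auto simp: q_def)
  have "cmod q * cmod q < cos \<alpha> * cmod q" using q by (intro mult_strict_right_mono) auto
  also have "\<dots> \<le> Re q" using q assms by (intro Arg_lt_imp_Re_ge) auto
  finally have "(cmod q)\<^sup>2 < 2 * Re q"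
    using zero_le_power2[of "cmod q"] unfolding power2_eq_square by linarith
  moreover have "(cmod (1 - q))\<^sup>2 = 1 - 2 * Re q + (cmod q)\<^sup>2"
    by (simp add: cmod_power2) (simp add: power2_eq_square algebra_simps)
  ultimately have "(cmod (1 - q))\<^sup>2 < 1\<^sup>2" by simp
  then have "cmod (1 - q) < 1" by (rule power2_less_imp_less) simp
  then show "z \<in> ball 0 1" using assms(1) by (simp add: zq norm_mult)
qed

text \<open>
  The map \<open>\<lambda>w. exp (\<i> * w)\<close> has derivative \<open>\<i> * cis x\<close> at \<open>x\<close>, so it distorts the small wedge of half-angle
  \<open>pi / 4\<close> only slightly; the half-angle \<open>pi / 3\<close> leaves room, and \<open>1/32\<close> is small enough.
\<close>

lemma exp_wedge_subset_angle:
  assumes w: "w \<in> wedge x h" and h: "h \<le> 1/32"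
  shows "exp (\<i> * w) \<in> angle_at (cis x) (pi/3) (2 * h)"
proof -
  define u where "u = \<i> * (w - of_real x)"
  define y where "y = Im w"
  define q where "q = 1 - exp u"
  have y: "\<bar>Re w - x\<bar> < y" "y < h" "0 < y" using w by (auto simp: wedge_def y_def)
  have Reu: "Re u = - y" and Imu: "Im u = Re w - x" by (simp_all add: u_def y_def)
  have exp_split: "exp (\<i> * w) = cis x * exp u"
    by (simp add: u_def cis_conv_exp algebra_simps flip: exp_add)
  have u2: "(cmod u)\<^sup>2 \<le> 2 * y\<^sup>2"
  proof -
    have "(Re w - x)\<^sup>2 \<le> y\<^sup>2" using y by (metis abs_le_square_iff abs_of_pos less_imp_le)
    then show ?thesis by (simp add: cmod_power2 Reu Imu)
  qed
  have u1: "cmod u \<le> 3/2 * y"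
  proof (rule power2_le_imp_le)
    have "2 * y\<^sup>2 \<le> 9/4 * y\<^sup>2" by simp
    also have "\<dots> = (3/2 * y)\<^sup>2" by (simp add: power2_eq_square)
    finally show "(cmod u)\<^sup>2 \<le> (3/2 * y)\<^sup>2" using u2 by linarith
  qed (use y in simp)
  have "cmod (exp u - (1 + u)) \<le> exp y * (cmod u)\<^sup>2"
    using Taylor_exp[of u 1] y by (simp add: Reu power2_eq_square)
  also have "\<dots> \<le> 2 * (2 * y\<^sup>2)"
  proof (rule mult_mono)
    have "exp y \<le> 1 + 2 * y" using y h by (intro real_exp_bound_lemma) auto
    then show "exp y \<le> 2" using y h by linarith
  qed (use u2 in auto)
  also have "2 * (2 * y\<^sup>2) \<le> y / 8"
  proof -
    have "y * y \<le> 1/32 * y" using y h by (intro mult_right_mono) auto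
    then show ?thesis by (simp add: power2_eq_square)
  qed
  finally have e: "cmod (q + u) \<le> y / 8"
    by (simp add: q_def norm_minus_commute algebra_simps)
  have Req: "y - y/8 \<le> Re q" using abs_Re_le_cmod[of "q + u"] e Reu by (simp add: abs_le_iff)
  have nq: "cmod q \<le> 3/2 * y + y/8"
    using norm_triangle_ineq4[of "q + u" u] e u1 by simp
  have dq: "(cis x - exp (\<i> * w)) / cis x = q" by (simp add: exp_split q_def field_simps)
  have "dist (exp (\<i> * w)) (cis x) = cmod (cis x * q)"
    by (simp add: dist_norm exp_split q_def norm_minus_commute algebra_simps)
  then have dist: "dist (exp (\<i> * w)) (cis x) = cmod q" by (simp add: norm_mult)
  have "0 < Re q" using Req y by linarith
  then have "0 < cmod q" by (auto simp: zero_less_norm_iff)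
  moreover have "cmod q < 2 * h" using nq y by linarith
  moreover have "\<bar>Arg q\<bar> < pi/3"
    using nq Req y by (intro cos_lt_imp_Arg_lt) (auto simp: cos_60)
  ultimately show ?thesis unfolding angle_at_def mem_Collect_eq dq dist by blast
qed

lemma angular_limit_imp_bounded_above:
  fixes g :: "complex \<Rightarrow> real"
  assumes lim: "has_angular_limit (\<lambda>z. ereal (g z)) L (cis x)" and "L < \<infinity>"
  shows "\<exists>h>0. \<exists>B. \<forall>w\<in>wedge x h. g (exp (\<i> * w)) \<le> B"
proof -
  obtain B where B: "L < ereal B"
  proof (cases L)
    case (real r)
    then have "L < ereal (r + 1)" by simp
    then show thesis by (rule that)
  next
    case MInf
    then have "L < ereal 0" by simp
    then show thesis by (rule that)
  qed (use \<open>L < \<infinity>\<close> in simp)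
  have sub: "angle_at (cis x) (pi/3) (1/2) \<subseteq> ball 0 1"
    by (rule angle_at_subset_ball) (auto simp: cos_60)
  have "((\<lambda>z. ereal (g z)) \<longlongrightarrow> L) (at (cis x) within angle_at (cis x) (pi/3) (1/2))"
    using lim sub unfolding has_angular_limit_def by simp
  then have "\<forall>\<^sub>F z in at (cis x) within angle_at (cis x) (pi/3) (1/2). ereal (g z) < ereal B"
    using B by (rule order_tendstoD(2))
  then obtain d where d: "d > 0" "\<And>z. z \<in> angle_at (cis x) (pi/3) (1/2) \<Longrightarrow> z \<noteq> cis x \<Longrightarrow> dist z (cis x) < d \<Longrightarrow> g z < B"
    unfolding eventually_at by auto
  define h where "h = min (1/32) (d/2)"
  have h: "0 < h" "h \<le> 1/32" "2 * h \<le> d" "2 * h \<le> 1/2" using d(1) by (auto simp: h_def)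
  have "g (exp (\<i> * w)) \<le> B" if "w \<in> wedge x h" for w
  proof -
    have "exp (\<i> * w) \<in> angle_at (cis x) (pi/3) (2 * h)"
      using that h(2) by (rule exp_wedge_subset_angle)
    then have "exp (\<i> * w) \<in> angle_at (cis x) (pi/3) (1/2)" "exp (\<i> * w) \<noteq> cis x" "dist (exp (\<i> * w)) (cis x) < d"
      using h by (auto simp: angle_at_def)
    then show ?thesis using d(2) by (simp add: less_imp_le)
  qed
  then show ?thesis using h(1) by blast
qed

text \<open>
  The inverse map, a branch of \<open>- \<i> * Ln\<close>, sends each angle, close to its vertex, into a Stolz region.
\<close>

lemma stolz_limit_imp_angular_limit:
  fixes g :: "complex \<Rightarrow> 'a::topological_space"
  assumes lim: "\<And>\<eta>. 0 < \<eta> \<Longrightarrow> ((\<lambda>w. g (exp (\<i> * w))) \<longlongrightarrow> l) (at (of_real x) within stolz \<eta> x)"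
  shows "has_angular_limit g l (cis x)"
  unfolding has_angular_limit_def
proof (intro allI impI, elim conjE)
  fix \<alpha> r :: real assume \<alpha>: "0 < \<alpha>" "\<alpha> < pi/2"
  define c where "c = cos \<alpha>"
  have c: "0 < c" "c \<le> 1" unfolding c_def using \<alpha> by (auto intro: cos_gt_zero)
  let ?F = "at (cis x) within angle_at (cis x) \<alpha> r"
  \<comment> \<open>A local inverse of \<open>\<lambda>w. exp (\<i> * w)\<close> that sends \<open>cis x\<close> to \<open>x\<close>.\<close>
  define W where "W z = of_real x - \<i> * Ln (z / cis x)" for z
  have expW: "exp (\<i> * W z) = z" if "z \<noteq> 0" for z
    using that by (simp add: W_def right_diff_distrib exp_diff exp_minus cis_conv_exp[symmetric] algebra_simps exp_add)
  have Wlim: "(W \<longlongrightarrow> of_real x) ?F"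
  proof -
    have "((\<lambda>z. of_real x - \<i> * Ln (z / cis x)) \<longlongrightarrow> of_real x - \<i> * Ln (cis x / cis x)) ?F"
      by (intro tendsto_intros) auto
    then show ?thesis by (simp add: W_def[abs_def])
  qed
  have key: "W z \<in> stolz (c/8) x \<and> W z \<noteq> of_real x \<and> z \<noteq> 0"
    if z: "z \<in> angle_at (cis x) \<alpha> r" "dist z (cis x) < c/4" for z
  proof -
    define q where "q = (cis x - z) / cis x"
    have zq: "z / cis x = 1 + (- q)" by (simp add: q_def field_simps)
    have nq: "cmod q = dist z (cis x)" by (simp add: q_def norm_divide dist_norm norm_minus_commute)
    have q: "\<bar>Arg q\<bar> < \<alpha>" "0 < cmod q" "cmod q < c/4"
      using z unfolding angle_at_def nq by (auto simp: q_def)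
    have Req: "c * cmod q \<le> Re q" unfolding c_def using q \<alpha> by (intro Arg_lt_imp_Re_ge) auto
    have "cmod (Ln (1 + (- q)) - (- q)) \<le> (cmod q)\<^sup>2 / (1 - cmod q)"
      using Ln_approx_linear[of "- q"] q c by simp
    also have "\<dots> \<le> (cmod q)\<^sup>2 / (1/2)" using q c by (intro divide_left_mono) auto
    also have "\<dots> = 2 * cmod q * cmod q" by (simp add: power2_eq_square)
    also have "\<dots> \<le> 2 * (c/4) * cmod q" using q by (intro mult_right_mono mult_left_mono) auto
    finally have e: "cmod (Ln (z / cis x) + q) \<le> c/2 * cmod q" by (simp add: zq)
    have d: "W z - of_real x = - \<i> * Ln (z / cis x)" by (simp add: W_def)
    have "Im (W z) = - Re (Ln (z / cis x))" by (simp add: W_def)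
    then have Im: "c/2 * cmod q \<le> Im (W z)"
      using abs_Re_le_cmod[of "Ln (z / cis x) + q"] e Req by (simp add: abs_le_iff)
    have "cmod (W z - of_real x) = cmod (Ln (z / cis x))" unfolding d by (simp add: norm_mult)
    also have "\<dots> \<le> cmod (Ln (z / cis x) + q) + cmod q"
      using norm_triangle_ineq4[of "Ln (z / cis x) + q" q] by simp
    also have "\<dots> \<le> c/2 * cmod q + cmod q" using e by simp
    also have "\<dots> \<le> 2 * cmod q"
    proof -
      have "c/2 * cmod q \<le> 1 * cmod q" using c by (intro mult_right_mono) auto
      then show ?thesis by simp
    qed
    finally have "c/8 * cmod (W z - of_real x) \<le> c/8 * (2 * cmod q)" using c by (intro mult_left_mono) auto
    also have "\<dots> < c/2 * cmod q"
      using mult_pos_pos[OF c(1) q(2)] by linarith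
    finally have "W z \<in> stolz (c/8) x" using Im by (simp add: stolz_def)
    moreover have "W z \<noteq> of_real x"
    proof
      assume "W z = of_real x"
      then have "Im (W z) = 0" by simp
      moreover have "0 < c/2 * cmod q" using mult_pos_pos[OF c(1) q(2)] by linarith
      ultimately show False using Im by linarith
    qed
    moreover have "z \<noteq> 0" using nq q c by auto
    ultimately show ?thesis by blast
  qed
  have ev: "\<forall>\<^sub>F z in ?F. W z \<in> stolz (c/8) x \<and> W z \<noteq> of_real x \<and> z \<noteq> 0"
    unfolding eventually_at using key c by (intro exI[of _ "c/4"]) auto
  have "filterlim W (at (of_real x) within stolz (c/8) x) ?F"
    unfolding filterlim_at using Wlim ev by (auto elim: eventually_mono)
  with lim[of "c/8"] c have "((\<lambda>z. g (exp (\<i> * W z))) \<longlongrightarrow> l) ?F"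
    by (auto intro: filterlim_compose)
  moreover have "\<forall>\<^sub>F z in ?F. g (exp (\<i> * W z)) = g z"
    using ev by eventually_elim (simp add: expW)
  ultimately show "(g \<longlongrightarrow> l) ?F" by (rule Lim_transform_eventually)
qed

section \<open>Radial limits and null sets of the circle\<close>

lemma radial_point_in_angle:
  assumes "cmod \<zeta> = 1" "0 < \<alpha>" "0 < t" "t < r"
  shows "of_real (1 - t) * \<zeta> \<in> angle_at \<zeta> \<alpha> r"
proof -
  have "\<zeta> \<noteq> 0" using assms(1) by auto
  then have "(\<zeta> - of_real (1 - t) * \<zeta>) / \<zeta> = of_real t" by (simp add: field_simps)
  moreover have "dist (of_real (1 - t) * \<zeta>) \<zeta> = t"
  proof -
    have "of_real (1 - t) * \<zeta> - \<zeta> = - (of_real t * \<zeta>)" by (simp add: algebra_simps)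
    then show ?thesis using assms by (simp add: dist_norm norm_mult)
  qed
  ultimately show ?thesis using assms \<open>\<zeta> \<noteq> 0\<close> unfolding angle_at_def mem_Collect_eq by simp
qed

text \<open>
  The radial sequence identifies angular limits and exhibits them as pointwise limits of continuous
  functions. The offset 3 keeps it within distance \<open>1/2\<close> of the boundary.
\<close>

lemma has_angular_limit_radial:
  assumes "cmod \<zeta> = 1" and lim: "has_angular_limit g L \<zeta>"
  shows "(\<lambda>n. g (of_real (1 - 1 / real (n + 3)) * \<zeta>)) \<longlonglongrightarrow> L"
proof -
  let ?A = "angle_at \<zeta> (pi/3) (1/2)"
  have "?A \<subseteq> ball 0 1"
    by (rule angle_at_subset_ball) (use assms(1) in \<open>auto simp: cos_60\<close>)
  then have lim': "(g \<longlongrightarrow> L) (at \<zeta> within ?A)" using lim unfolding has_angular_limit_def by simp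
  have mem: "of_real (1 - 1 / real (n + 3)) * \<zeta> \<in> ?A" for n
    using assms(1) by (intro radial_point_in_angle) auto
  have "filterlim (\<lambda>n. of_real (1 - 1 / real (n + 3)) * \<zeta>) (at \<zeta> within ?A) sequentially"
    unfolding filterlim_at
  proof
    have "(\<lambda>n. 1 / real (n + 3)) \<longlonglongrightarrow> 0"
      by (rule LIMSEQ_ignore_initial_segment[OF lim_const_over_n])
    then have "(\<lambda>n. of_real (1 - 1 / real (n + 3)) * \<zeta>) \<longlonglongrightarrow> of_real (1 - 0) * \<zeta>"
      by (intro tendsto_intros)
    then show "(\<lambda>n. of_real (1 - 1 / real (n + 3)) * \<zeta>) \<longlonglongrightarrow> \<zeta>" by simp
    have "of_real (1 - 1 / real (n + 3)) * \<zeta> \<noteq> \<zeta>" for n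
      using mem[of n] by (metis (no_types, lifting) angle_at_def dist_self less_irrefl mem_Collect_eq)
    then show "\<forall>\<^sub>F n in sequentially. of_real (1 - 1 / real (n + 3)) * \<zeta> \<in> ?A \<and> of_real (1 - 1 / real (n + 3)) * \<zeta> \<noteq> \<zeta>"
      using mem by (intro always_eventually allI conjI)
  qed
  with lim' show ?thesis by (rule filterlim_compose)
qed

lemma angular_limit_radial:
  fixes g :: "complex \<Rightarrow> 'a::t2_space"
  assumes "cmod \<zeta> = 1" "has_angular_limit g L \<zeta>"
  shows "(\<lambda>n. g (of_real (1 - 1 / real (n + 3)) * \<zeta>)) \<longlonglongrightarrow> angular_limit g \<zeta>"
proof -
  have "angular_limit g \<zeta> = L"
    unfolding angular_limit_def
  proof (rule the_equality)
    show "L' = L" if "has_angular_limit g L' \<zeta>" for L'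
      using has_angular_limit_radial[OF assms(1) that] has_angular_limit_radial[OF assms]
      by (rule LIMSEQ_unique)
  qed (rule assms(2))
  then show ?thesis using has_angular_limit_radial[OF assms] by simp
qed

lemma space_arc_length: "space arc_length = sphere 0 1"
  by (simp add: arc_length_def space_restrict_space)

lemma continuous_imp_measurable_arc_length:
  fixes g :: "complex \<Rightarrow> 'a::topological_space"
  assumes "continuous_on (sphere 0 1) g"
  shows "g \<in> borel_measurable arc_length"
proof -
  have "g \<in> borel_measurable (restrict_space borel (sphere 0 1))"
    using assms by (rule borel_measurable_continuous_on_restrict)
  then show ?thesis unfolding arc_length_def by (intro measurable_completion) simp
qed

lemma continuous_on_radial_dilation:
  fixes g :: "complex \<Rightarrow> 'a::topological_space"
  assumes "continuous_on (ball 0 1) g" "0 \<le> t" "t < 1"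
  shows "continuous_on (sphere 0 1) (\<lambda>\<zeta>. g (of_real t * \<zeta>))"
  by (rule continuous_on_compose2[OF assms(1)]) (use assms in \<open>auto intro!: continuous_intros simp: norm_mult\<close>)

lemma borel_measurable_Arg2pi: "Arg2pi \<in> borel_measurable borel"
proof -
  have cl: "closed {z :: complex. Im z = 0 \<and> 0 \<le> Re z}"
    by (intro closed_Collect_conj closed_Collect_eq closed_Collect_le continuous_intros)
  have "(\<lambda>z. if z \<in> {z. Im z = 0 \<and> 0 \<le> Re z} then 0 else Arg2pi z) \<in> borel_measurable borel"
  proof (rule borel_measurable_continuous_on_if)
    show "continuous_on (- {z. Im z = 0 \<and> 0 \<le> Re z}) Arg2pi"
      by (rule continuous_at_imp_continuous_on) (auto intro!: continuous_at_Arg2pi simp: complex_nonneg_Reals_iff)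
  qed (use cl in auto)
  moreover have "(\<lambda>z. if z \<in> {z. Im z = 0 \<and> 0 \<le> Re z} then 0 else Arg2pi z) = Arg2pi"
    by (auto simp: fun_eq_iff Arg2pi_eq_0 complex_is_Real_iff)
  ultimately show ?thesis by simp
qed

lemma Arg2pi_cis: "0 \<le> x \<Longrightarrow> x < 2 * pi \<Longrightarrow> Arg2pi (cis x) = x"
  by (rule Arg2pi_unique[of 1]) (auto simp: cis_conv_exp)

text \<open>
  A Borel null set of parameters that covers the bad ones is pulled back by \<open>Arg2pi\<close>, the inverse of
  the parametrization.
\<close>

lemma AE_arc_lengthI:
  assumes "AE x in lborel. P (cis x)"
  shows "AE \<zeta> in arc_length. P \<zeta>"
proof -
  obtain N where N: "N \<in> null_sets lborel" "{x. \<not> P (cis x)} \<subseteq> N"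
    using assms by (auto simp: eventually_ae_filter)
  define N' where "N' = {\<zeta> \<in> sphere 0 1. Arg2pi \<zeta> \<in> N}"
  let ?M = "restrict_space lborel {0..<2 * pi}" and ?S = "restrict_space borel (sphere (0::complex) 1)"
  have N'm: "N' \<in> sets ?S"
  proof -
    have "Arg2pi -` N \<inter> space borel \<in> sets borel"
      using borel_measurable_Arg2pi N(1) by (intro measurable_sets) auto
    then show ?thesis by (auto simp: N'_def sets_restrict_space)
  qed
  have cism: "cis \<in> measurable ?M ?S"
  proof (rule measurable_restrict_space2)
    have "cis \<in> borel_measurable borel" by (intro borel_measurable_continuous_onI continuous_intros)
    then show "cis \<in> borel_measurable ?M" by (intro measurable_restrict_space1) simp
  qed auto
  have "emeasure (distr ?M ?S cis) N' = emeasure ?M (cis -` N' \<inter> space ?M)"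
    by (rule emeasure_distr[OF cism N'm])
  also have "cis -` N' \<inter> space ?M = N \<inter> {0..<2 * pi}"
    by (auto simp: N'_def space_restrict_space Arg2pi_cis)
  also have "emeasure ?M (N \<inter> {0..<2 * pi}) = emeasure lborel (N \<inter> {0..<2 * pi})"
    by (intro emeasure_restrict_space) auto
  also have "\<dots> = 0"
    using N(1) by (metis null_setsD1 null_set_Int2 sets_lborel atLeastLessThan_borel)
  finally have "N' \<in> null_sets (distr ?M ?S cis)" using N'm by (simp add: null_sets_def)
  then have "AE \<zeta> in distr ?M ?S cis. P \<zeta>"
  proof (rule AE_I')
    show "{\<zeta> \<in> space (distr ?M ?S cis). \<not> P \<zeta>} \<subseteq> N'"
    proof
      fix \<zeta> assume "\<zeta> \<in> {\<zeta> \<in> space (distr ?M ?S cis). \<not> P \<zeta>}"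
      then have z: "cmod \<zeta> = 1" "\<not> P \<zeta>" by (auto simp: space_restrict_space)
      then have "cis (Arg2pi \<zeta>) = \<zeta>" using complex_norm_eq_1_exp by (simp add: cis_conv_exp)
      then have "Arg2pi \<zeta> \<in> N" using z(2) N(2) by auto
      then show "\<zeta> \<in> N'" using z(1) by (simp add: N'_def)
    qed
  qed
  then show ?thesis unfolding arc_length_def by (rule AE_completion)
qed

lemma holomorphic_exp_pullback:
  assumes "f holomorphic_on ball 0 1"
  shows "(\<lambda>w. f (exp (\<i> * w))) holomorphic_on {w. 0 < Im w}"
proof -
  have "f \<circ> (\<lambda>w. exp (\<i> * w)) holomorphic_on {w. 0 < Im w}"
    by (rule holomorphic_on_compose_gen[OF _ assms]) (auto intro!: holomorphic_intros)
  then show ?thesis by (simp add: o_def)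
qed

section \<open>Angular limits of conjugate harmonic functions\<close>

theorem theorem1:
  fixes u v :: "complex \<Rightarrow> real" and E :: "complex set"
  assumes "harmonic_on u (ball 0 1)"
    and "E \<in> sets arc_length"
    and "\<forall>\<zeta>\<in>E. \<exists>L::ereal. has_angular_limit (\<lambda>z. ereal (u z)) L \<zeta>"
    and "harmonic_conjugate_on u v (ball 0 1)"
  shows "(AE \<zeta> in arc_length. \<zeta> \<in> E \<longrightarrow> (\<exists>l::real. has_angular_limit v l \<zeta>)) \<and>
    angular_limit (\<lambda>z. ereal (u z)) \<in> borel_measurable (restrict_space arc_length E) \<and>
    angular_limit v \<in> borel_measurable
      (restrict_space arc_length {\<zeta>\<in>E. \<exists>l::real. has_angular_limit v l \<zeta>})"
proof (intro conjI)
  define f where "f z = complex_of_real (u z) + \<i> * complex_of_real (v z)" for z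
  have hol: "f holomorphic_on ball 0 1"
    using assms(4) unfolding harmonic_conjugate_on_def f_def by (auto intro: analytic_imp_holomorphic)
  have cont: "continuous_on (ball 0 1) f" using hol by (rule holomorphic_on_imp_continuous_on)
  have Ref: "Re (f z) = u z" and Imf: "Im (f z) = v z" for z by (simp_all add: f_def)
  have contu: "continuous_on (ball 0 1) u" and contv: "continuous_on (ball 0 1) v"
    using continuous_on_Re[OF cont] continuous_on_Im[OF cont] by (simp_all add: Ref Imf)
  have E: "E \<subseteq> sphere 0 1" using sets.sets_into_space[OF assms(2)] by (simp add: space_arc_length)
  define F where "F w = f (exp (\<i> * w))" for w
  have holF: "F holomorphic_on {w. 0 < Im w}" unfolding F_def by (rule holomorphic_exp_pullback[OF hol])
  have holnF: "(\<lambda>w. - F w) holomorphic_on {w. 0 < Im w}" using holF by (rule holomorphic_on_minus)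
  show "AE \<zeta> in arc_length. \<zeta> \<in> E \<longrightarrow> (\<exists>l::real. has_angular_limit v l \<zeta>)"
  proof (rule AE_arc_lengthI)
    show "AE x in lborel. cis x \<in> E \<longrightarrow> (\<exists>l::real. has_angular_limit v l (cis x))"
      using local_privalov[OF holF] local_privalov[OF holnF]
    proof eventually_elim
      case (elim x)
      show ?case
      proof
        assume "cis x \<in> E"
        then obtain L where L: "has_angular_limit (\<lambda>z. ereal (u z)) L (cis x)" using assms(3) by blast
        have "\<exists>l. \<forall>\<eta>>0. (F \<longlongrightarrow> l) (at (of_real x) within stolz \<eta> x)"
        \<comment> \<open>In the second case \<open>- u\<close> has the angular limit \<open>- \<infinity>\<close>, so \<open>Re (- F)\<close> is bounded above.\<close>
        proof (cases "L < \<infinity>")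
          case True
          from angular_limit_imp_bounded_above[OF L this]
          have "\<exists>h>0. \<exists>B. \<forall>w\<in>wedge x h. Re (F w) \<le> B" by (simp add: F_def Ref)
          then show ?thesis using elim(1) by blast
        next
          case False
          have "has_angular_limit (\<lambda>z. ereal (- u z)) (- L) (cis x)"
            using L unfolding has_angular_limit_def by (auto intro: tendsto_uminus_ereal[of _ _ , folded uminus_ereal.simps(1)] simp flip: uminus_ereal.simps(1))
          moreover have "- L < \<infinity>" using False by auto
          ultimately have "\<exists>h>0. \<exists>B. \<forall>w\<in>wedge x h. - u (exp (\<i> * w)) \<le> B"
            by (rule angular_limit_imp_bounded_above)
          then have "\<exists>h>0. \<exists>B. \<forall>w\<in>wedge x h. Re (- F w) \<le> B" by (simp add: F_def Ref)
          then obtain l where l: "\<And>\<eta>. \<eta> > 0 \<Longrightarrow> ((\<lambda>w. - F w) \<longlongrightarrow> l) (at (of_real x) within stolz \<eta> x)"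
            using elim(2) by blast
          have "(F \<longlongrightarrow> - l) (at (of_real x) within stolz \<eta> x)" if "\<eta> > 0" for \<eta>
            using tendsto_minus[OF l[OF that]] by simp
          then show ?thesis by blast
        qed
        then obtain l where l: "\<And>\<eta>. \<eta> > 0 \<Longrightarrow> (F \<longlongrightarrow> l) (at (of_real x) within stolz \<eta> x)" by blast
        have "has_angular_limit v (Im l) (cis x)"
        proof (rule stolz_limit_imp_angular_limit)
          show "((\<lambda>w. v (exp (\<i> * w))) \<longlongrightarrow> Im l) (at (of_real x) within stolz \<eta> x)" if "0 < \<eta>" for \<eta>
            using tendsto_Im[OF l[OF that]] by (simp add: F_def Imf)
        qed
        then show "\<exists>l::real. has_angular_limit v l (cis x)" ..
      qed
    qed
  qed
  have dil: "0 \<le> 1 - 1 / real (n + 3)" "1 - 1 / real (n + 3) < 1" for n by (auto simp: field_simps)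
  show "angular_limit (\<lambda>z. ereal (u z)) \<in> borel_measurable (restrict_space arc_length E)"
  proof (rule borel_measurable_LIMSEQ_order)
    show "(\<lambda>\<zeta>. ereal (u (of_real (1 - 1 / real (n + 3)) * \<zeta>))) \<in> borel_measurable (restrict_space arc_length E)" for n
      using contu by (intro measurable_restrict_space1 continuous_imp_measurable_arc_length
          continuous_on_radial_dilation[OF _ dil] continuous_on_ereal)
    fix \<zeta> assume "\<zeta> \<in> space (restrict_space arc_length E)"
    then have "cmod \<zeta> = 1" "\<zeta> \<in> E" using E by (auto simp: space_restrict_space)
    then show "(\<lambda>n. ereal (u (of_real (1 - 1 / real (n + 3)) * \<zeta>))) \<longlonglongrightarrow> angular_limit (\<lambda>z. ereal (u z)) \<zeta>"
      using assms(3) angular_limit_radial[of \<zeta> "\<lambda>z. ereal (u z)"] by blast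
  qed
  let ?Ev = "{\<zeta>\<in>E. \<exists>l::real. has_angular_limit v l \<zeta>}"
  show "angular_limit v \<in> borel_measurable (restrict_space arc_length ?Ev)"
  proof (rule borel_measurable_LIMSEQ_real)
    show "(\<lambda>\<zeta>. v (of_real (1 - 1 / real (n + 3)) * \<zeta>)) \<in> borel_measurable (restrict_space arc_length ?Ev)" for n
      using contv by (intro measurable_restrict_space1 continuous_imp_measurable_arc_length
          continuous_on_radial_dilation[OF _ dil])
    fix \<zeta> assume "\<zeta> \<in> space (restrict_space arc_length ?Ev)"
    then have "cmod \<zeta> = 1" "\<exists>l. has_angular_limit v l \<zeta>" using E by (auto simp: space_restrict_space)
    then show "(\<lambda>n. v (of_real (1 - 1 / real (n + 3)) * \<zeta>)) \<longlonglongrightarrow> angular_limit v \<zeta>"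
      using angular_limit_radial[of \<zeta> v] by blast
  qed
qed

end
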